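(* (1) For every finite group $G$ there exists a first-order sentence $S(G)$ in the language of rings, without parameters or additional constants, such that for every field $K$: $K \models S(G)$ if and only if $\mathrm{IGP}(K,G)$ has a solution. (2) The sentence $S(G)$ depends only on the multiplication table of $G$, and there exists an effective procedure taking the multiplication table of $G$ as its input and producing $S(G)$. (3) For every field $K$ (and every $d\in\mathbb{N}$) we have $\mathcal{H}_{K,d} \leq_T \mathrm{Th}(K)$, and the Turing reduction (i.e. the construction of the sentence $S(G)$) is independent of $K$.
   Context: The language of rings is $(0,1,+,\times)$. For a field $K$ and a finite group $G$, $\mathrm{IGP}(K,G)$ has a solution if there is a Galois extension $L/K$ (of degree $|G|$) with $\mathrm{Gal}(L/K)\cong G$. $\mathrm{Th}(K)$ is the set of all sentences of the language of rings (no parameters, no additional constants) true in $K$; sentences are identified with natural numbers via a fixed effective bijection, so $\mathrm{Th}(K)$ is regarded as a subset of $\mathbb{N}$. Let $\mathcal{G}$ be a set of representatives of the isomorphism classes of finite groups and $\sigma:\mathcal{G}\to\mathbb{N}$ a fixed effective bijection: $\sigma(G)$ can be computed from a multiplication table of $G$, and a multiplication table of $G$ can be computed from $\sigma(G)$. For a field $K$ and $d\in\mathbb{N}$, $\mathcal{H}_{K,d}$ is the set of all $n\in\mathbb{N}$ such that the group $\sigma^{-1}(n)$ has order $d$ and $K$ has a Galois extension with Galois group isomorphic to $\sigma^{-1}(n)$. For sets $A,B$ of integers, $A\leq_T B$ means that there is an algorithm taking the characteristic function of $B$ as input (oracle) and generating the characteristic function of $A$. *)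

theory Defs
  imports "HOL-Algebra.Algebra" "HOL-Library.Nat_Bijection"
begin

section \<open>The first-order language of rings\<close>

text \<open>Variables are de Bruijn indices: in \<open>Ex \<phi>\<close>, index 0 is the variable bound by the quantifier.\<close>

datatype ring_term = TVar nat | TZero | TOne | TAdd ring_term ring_term | TMul ring_term ring_term

datatype ring_formula =
    Equal ring_term ring_term
  | Neg ring_formula
  | Conj ring_formula ring_formula
  | Ex ring_formula

primrec term_in :: "nat \<Rightarrow> ring_term \<Rightarrow> bool" where
  "term_in n (TVar i) \<longleftrightarrow> i < n"
| "term_in n TZero \<longleftrightarrow> True"
| "term_in n TOne \<longleftrightarrow> True"
| "term_in n (TAdd s t) \<longleftrightarrow> term_in n s \<and> term_in n t"
| "term_in n (TMul s t) \<longleftrightarrow> term_in n s \<and> term_in n t"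

primrec formula_in :: "nat \<Rightarrow> ring_formula \<Rightarrow> bool" where
  "formula_in n (Equal s t) \<longleftrightarrow> term_in n s \<and> term_in n t"
| "formula_in n (Neg \<phi>) \<longleftrightarrow> formula_in n \<phi>"
| "formula_in n (Conj \<phi> \<psi>) \<longleftrightarrow> formula_in n \<phi> \<and> formula_in n \<psi>"
| "formula_in n (Ex \<phi>) \<longleftrightarrow> formula_in (Suc n) \<phi>"

definition sentence :: "ring_formula \<Rightarrow> bool" where
  "sentence \<phi> \<longleftrightarrow> formula_in 0 \<phi>"

primrec term_val :: "('a, 'b) ring_scheme \<Rightarrow> 'a list \<Rightarrow> ring_term \<Rightarrow> 'a" where
  "term_val K e (TVar i) = e ! i"
| "term_val K e TZero = \<zero>\<^bsub>K\<^esub>"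
| "term_val K e TOne = \<one>\<^bsub>K\<^esub>"
| "term_val K e (TAdd s t) = term_val K e s \<oplus>\<^bsub>K\<^esub> term_val K e t"
| "term_val K e (TMul s t) = term_val K e s \<otimes>\<^bsub>K\<^esub> term_val K e t"

primrec satisfies :: "('a, 'b) ring_scheme \<Rightarrow> 'a list \<Rightarrow> ring_formula \<Rightarrow> bool" where
  "satisfies K e (Equal s t) \<longleftrightarrow> term_val K e s = term_val K e t"
| "satisfies K e (Neg \<phi>) \<longleftrightarrow> \<not> satisfies K e \<phi>"
| "satisfies K e (Conj \<phi> \<psi>) \<longleftrightarrow> satisfies K e \<phi> \<and> satisfies K e \<psi>"
| "satisfies K e (Ex \<phi>) \<longleftrightarrow> (\<exists>x\<in>carrier K. satisfies K (x # e) \<phi>)"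

definition models :: "('a, 'b) ring_scheme \<Rightarrow> ring_formula \<Rightarrow> bool" (infix \<open>\<Turnstile>\<close> 50) where
  "K \<Turnstile> \<phi> \<longleftrightarrow> satisfies K [] \<phi>"

text \<open>For each \<open>n\<close>, \<open>term_code n\<close> and \<open>formula_code n\<close> number the terms and formulas whose free
  variables are among the first \<open>n\<close>, without gaps. Hence \<open>formula_code 0\<close> is an effective bijection
  from sentences to natural numbers (lemma \<open>bij_sentence_code\<close> below).\<close>

primrec term_code :: "nat \<Rightarrow> ring_term \<Rightarrow> nat" where
  "term_code n (TVar i) = i"
| "term_code n TZero = n"
| "term_code n TOne = n + 1"
| "term_code n (TAdd s t) = n + 2 + 2 * prod_encode (term_code n s, term_code n t)"
| "term_code n (TMul s t) = n + 3 + 2 * prod_encode (term_code n s, term_code n t)"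

primrec formula_code :: "nat \<Rightarrow> ring_formula \<Rightarrow> nat" where
  "formula_code n (Equal s t) = 4 * prod_encode (term_code n s, term_code n t)"
| "formula_code n (Neg \<phi>) = 4 * formula_code n \<phi> + 1"
| "formula_code n (Conj \<phi> \<psi>) = 4 * prod_encode (formula_code n \<phi>, formula_code n \<psi>) + 2"
| "formula_code n (Ex \<phi>) = 4 * formula_code (Suc n) \<phi> + 3"

definition sentence_code :: "ring_formula \<Rightarrow> nat" where
  "sentence_code \<phi> = formula_code 0 \<phi>"

lemma term_code_inj:
  "term_in n s \<Longrightarrow> term_in n t \<Longrightarrow> term_code n s = term_code n t \<Longrightarrow> s = t"
proof (induction s arbitrary: t)
  case (TVar i)
  then show ?case by (cases t) auto
next
  case TZero
  then show ?case by (cases t) auto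
next
  case TOne
  then show ?case by (cases t) auto
next
  case (TAdd s1 s2)
  show ?case
  proof (cases t)
    case (TMul t1 t2)
    with TAdd.prems show ?thesis by simp presburger
  qed (use TAdd in auto)
next
  case (TMul s1 s2)
  show ?case
  proof (cases t)
    case (TAdd t1 t2)
    with TMul.prems show ?thesis by simp presburger
  qed (use TMul in auto)
qed

lemma term_code_surj: "\<exists>t. term_in n t \<and> term_code n t = k"
proof (induction k rule: less_induct)
  case (less k)
  consider "k < n" | "k = n" | "k = n + 1" | c where "k = n + 2 + 2 * c" | c where "k = n + 3 + 2 * c"
  proof -
    have "k < n \<or> k = n \<or> k = n + 1 \<or> (\<exists>c. k = n + 2 + 2 * c) \<or> (\<exists>c. k = n + 3 + 2 * c)"
      by presburger
    then show ?thesis using that by blast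
  qed
  then show ?case
  proof cases
    case 1
    then show ?thesis by (intro exI[of _ "TVar k"]) simp
  next
    case 2
    then show ?thesis by (intro exI[of _ TZero]) simp
  next
    case 3
    then show ?thesis by (intro exI[of _ TOne]) simp
  next
    case 4
    obtain a b where ab: "c = prod_encode (a, b)" by (metis prod_decode_inverse surj_pair)
    with 4 le_prod_encode_1[of a b] le_prod_encode_2[of b a] have "a < k" "b < k" by auto
    with less obtain s t where "term_in n s" "term_code n s = a" "term_in n t" "term_code n t = b"
      by blast
    then show ?thesis using 4 ab by (intro exI[of _ "TAdd s t"]) simp
  next
    case 5
    obtain a b where ab: "c = prod_encode (a, b)" by (metis prod_decode_inverse surj_pair)
    with 5 le_prod_encode_1[of a b] le_prod_encode_2[of b a] have "a < k" "b < k" by auto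
    with less obtain s t where "term_in n s" "term_code n s = a" "term_in n t" "term_code n t = b"
      by blast
    then show ?thesis using 5 ab by (intro exI[of _ "TMul s t"]) simp
  qed
qed

lemma formula_code_mod:
  "formula_code n \<phi> mod 4 =
     (case \<phi> of Equal s t \<Rightarrow> 0 | Neg \<psi> \<Rightarrow> 1 | Conj \<psi> \<chi> \<Rightarrow> 2 | Ex \<psi> \<Rightarrow> 3)"
  by (cases \<phi>; simp; presburger)

lemma formula_code_inj:
  "formula_in n \<phi> \<Longrightarrow> formula_in n \<psi> \<Longrightarrow> formula_code n \<phi> = formula_code n \<psi> \<Longrightarrow> \<phi> = \<psi>"
proof (induction \<phi> arbitrary: n \<psi>)
  case (Equal s t)
  then show ?case
    using formula_code_mod[of n "Equal s t"] formula_code_mod[of n \<psi>]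
    by (cases \<psi>) (auto dest: term_code_inj)
next
  case (Neg \<phi>)
  then show ?case
    using formula_code_mod[of n "Neg \<phi>"] formula_code_mod[of n \<psi>]
    by (cases \<psi>) auto
next
  case (Conj \<phi>1 \<phi>2)
  then show ?case
    using formula_code_mod[of n "Conj \<phi>1 \<phi>2"] formula_code_mod[of n \<psi>]
    by (cases \<psi>) auto
next
  case (Ex \<phi>)
  have "formula_code n \<psi> mod 4 = 3"
    using Ex.prems(3) formula_code_mod[of n "Ex \<phi>"] by (simp del: formula_code.simps)
  then obtain \<chi> where "\<psi> = Ex \<chi>"
    using formula_code_mod[of n \<psi>] by (auto split: ring_formula.splits)
  with Ex show ?case by auto
qed

lemma formula_code_surj: "\<exists>\<phi>. formula_in n \<phi> \<and> formula_code n \<phi> = k"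
proof (induction k arbitrary: n rule: less_induct)
  case (less k)
  obtain c where c: "k = 4 * c \<or> k = 4 * c + 1 \<or> k = 4 * c + 2 \<or> k = 4 * c + 3"
  proof -
    have "\<exists>c. k = 4 * c \<or> k = 4 * c + 1 \<or> k = 4 * c + 2 \<or> k = 4 * c + 3" by presburger
    then show ?thesis using that by blast
  qed
  obtain a b where ab: "c = prod_encode (a, b)" by (metis prod_decode_inverse surj_pair)
  from c consider "k = 4 * c" | "k = 4 * c + 1" | "k = 4 * c + 2" | "k = 4 * c + 3" by blast
  then show ?case
  proof cases
    case 1
    obtain s t where "term_in n s" "term_code n s = a" "term_in n t" "term_code n t = b"
      using term_code_surj by meson
    then show ?thesis using 1 ab by (intro exI[of _ "Equal s t"]) simp
  next
    case 2
    then have "c < k" by simp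
    with less obtain \<phi> where "formula_in n \<phi>" "formula_code n \<phi> = c" by blast
    then show ?thesis using 2 by (intro exI[of _ "Neg \<phi>"]) simp
  next
    case 3
    with ab le_prod_encode_1[of a b] le_prod_encode_2[of b a] have "a < k" "b < k" by auto
    with less obtain \<phi> \<psi> where
      "formula_in n \<phi>" "formula_code n \<phi> = a" "formula_in n \<psi>" "formula_code n \<psi> = b" by meson
    then show ?thesis using 3 ab by (intro exI[of _ "Conj \<phi> \<psi>"]) simp
  next
    case 4
    then have "c < k" by simp
    with less obtain \<phi> where "formula_in (Suc n) \<phi>" "formula_code (Suc n) \<phi> = c" by blast
    then show ?thesis using 4 by (intro exI[of _ "Ex \<phi>"]) simp
  qed
qed

lemma bij_sentence_code: "bij_betw sentence_code {\<phi>. sentence \<phi>} UNIV"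
proof (rule bij_betwI')
  show "\<exists>\<phi>\<in>{\<phi>. sentence \<phi>}. k = sentence_code \<phi>" for k
    using formula_code_surj[of 0 k] by (auto simp: sentence_def sentence_code_def)
qed (auto simp: sentence_def sentence_code_def dest: formula_code_inj)

definition Th :: "('a, 'b) ring_scheme \<Rightarrow> nat set" where
  "Th K = sentence_code ` {\<phi>. sentence \<phi> \<and> K \<Turnstile> \<phi>}"


section \<open>Relative computability\<close>

datatype program =
    Zero
  | Succ
  | Proj nat
  | Oracle
  | Comp program "program list"
  | PrimRec program program
  | Minim program

text \<open>\<open>computes B p xs y\<close>: the partial recursive function described by \<open>p\<close>, relative to the
  characteristic function of \<open>B\<close>, is defined at \<open>xs\<close> with value \<open>y\<close>.\<close>

inductive computes :: "nat set \<Rightarrow> program \<Rightarrow> nat list \<Rightarrow> nat \<Rightarrow> bool" for B :: "nat set" where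
  zero: "computes B Zero xs 0"
| succ: "computes B Succ [x] (Suc x)"
| proj: "i < length xs \<Longrightarrow> computes B (Proj i) xs (xs ! i)"
| query: "computes B Oracle [x] (of_bool (x \<in> B))"
| comp: "list_all2 (\<lambda>q y. computes B q xs y) qs ys \<Longrightarrow> computes B p ys z
    \<Longrightarrow> computes B (Comp p qs) xs z"
| rec_0: "computes B p xs y \<Longrightarrow> computes B (PrimRec p q) (0 # xs) y"
| rec_Suc: "computes B (PrimRec p q) (n # xs) r \<Longrightarrow> computes B q (n # r # xs) y
    \<Longrightarrow> computes B (PrimRec p q) (Suc n # xs) y"
| minim: "computes B p (n # xs) 0 \<Longrightarrow> (\<And>m. m < n \<Longrightarrow> \<exists>v>0. computes B p (m # xs) v)
    \<Longrightarrow> computes B (Minim p) xs n"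

inductive_cases computes_zeroE: "computes B Zero xs y"
inductive_cases computes_succE: "computes B Succ xs y"
inductive_cases computes_projE: "computes B (Proj i) xs y"
inductive_cases computes_queryE: "computes B Oracle xs y"
inductive_cases computes_compE: "computes B (Comp p qs) xs y"
inductive_cases computes_rec_0E: "computes B (PrimRec p q) (0 # xs) y"
inductive_cases computes_rec_SucE: "computes B (PrimRec p q) (Suc n # xs) y"
inductive_cases computes_minimE: "computes B (Minim p) xs y"

lemma computes_deterministic:
  "computes B p xs y \<Longrightarrow> computes B p xs z \<Longrightarrow> y = z"
proof (induction arbitrary: z rule: computes.induct)
  case (zero xs)
  then show ?case by (blast elim: computes_zeroE)
next
  case (succ x)
  then show ?case by (blast elim: computes_succE)
next
  case (proj i xs)
  then show ?case by (blast elim: computes_projE)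
next
  case (query x)
  then show ?case by (blast elim: computes_queryE)
next
  case (comp xs qs ys p z')
  from comp.prems obtain ys' where
    ys': "list_all2 (\<lambda>q y. computes B q xs y) qs ys'" and z: "computes B p ys' z"
    by (rule computes_compE)
  have "ys = ys'"
    using comp.IH(1) ys' by (auto simp: list_all2_conv_all_nth intro!: nth_equalityI)
  with comp.IH z show ?case by blast
next
  case (rec_0 p xs y q)
  from rec_0.prems have "computes B p xs z" by (rule computes_rec_0E)
  with rec_0.IH show ?case by blast
next
  case (rec_Suc p q n xs r y)
  from rec_Suc.prems obtain r' where "computes B (PrimRec p q) (n # xs) r'"
    and "computes B q (n # r' # xs) z"
    by (rule computes_rec_SucE)
  with rec_Suc.IH show ?case by blast
next
  case (minim p n xs)
  from minim.prems have z: "computes B p (z # xs) 0" "\<And>m. m < z \<Longrightarrow> \<exists>v>0. computes B p (m # xs) v"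
    by (blast elim: computes_minimE)+
  show ?case
  proof (rule linorder_cases[of n z])
    assume "n < z"
    with z(2) obtain v where "v > 0" "computes B p (n # xs) v" by blast
    with minim.IH(1) show ?thesis by blast
  next
    assume "z < n"
    with minim.IH(2) obtain v where "v > 0" "\<forall>w. computes B p (z # xs) w \<longrightarrow> v = w" by blast
    with z(1) show ?thesis by blast
  qed simp
qed

definition reduces_via :: "program \<Rightarrow> nat set \<Rightarrow> nat set \<Rightarrow> bool" where
  "reduces_via p A B \<longleftrightarrow> (\<forall>x. computes B p [x] (of_bool (x \<in> A)))"

definition turing_reducible :: "nat set \<Rightarrow> nat set \<Rightarrow> bool" (infix \<open>\<le>\<^sub>T\<close> 50) where
  "A \<le>\<^sub>T B \<longleftrightarrow> (\<exists>p. reduces_via p A B)"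


section \<open>Multiplication tables\<close>

definition mult_table :: "('g, 'm) monoid_scheme \<Rightarrow> nat list list \<Rightarrow> bool" where
  "mult_table G T \<longleftrightarrow>
    (\<exists>xs. distinct xs \<and> set xs = carrier G \<and> length T = length xs \<and>
      (\<forall>i<length xs. length (T ! i) = length xs \<and>
        (\<forall>j<length xs. T ! i ! j < length xs \<and> xs ! (T ! i ! j) = xs ! i \<otimes>\<^bsub>G\<^esub> xs ! j)))"

lemma finite_group_has_mult_table:
  assumes "group G" "finite (carrier G)"
  shows "\<exists>T. mult_table G T"
proof -
  interpret group G by fact
  obtain xs where xs: "set xs = carrier G" "distinct xs"
    using assms(2) finite_distinct_list by blast
  define ix where "ix x = (SOME k. k < length xs \<and> xs ! k = x)" for x
  have ix: "ix x < length xs \<and> xs ! ix x = x" if "x \<in> carrier G" for x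
    unfolding ix_def by (rule someI_ex) (metis that xs(1) in_set_conv_nth)
  have "xs ! i \<otimes>\<^bsub>G\<^esub> xs ! j \<in> carrier G" if "i < length xs" "j < length xs" for i j
    using that xs(1) by (metis m_closed nth_mem)
  then have "mult_table G (map (\<lambda>x. map (\<lambda>y. ix (x \<otimes>\<^bsub>G\<^esub> y)) xs) xs)"
    unfolding mult_table_def using xs ix by (intro exI[of _ xs]) simp
  then show ?thesis by blast
qed

definition group_table :: "nat list list \<Rightarrow> bool" where
  "group_table T \<longleftrightarrow> (\<exists>G :: nat monoid. group G \<and> mult_table G T)"

definition table_code :: "nat list list \<Rightarrow> nat" where
  "table_code T = list_encode (map list_encode T)"

text \<open>An effective bijection \<open>\<sigma>\<close> from a set \<open>\<G>\<close> of representatives of the finite groups up to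
  isomorphism to the natural numbers; \<open>tab n\<close> is the computed multiplication table of the group
  numbered \<open>n\<close>. Two groups are isomorphic iff they share a multiplication table.\<close>

locale effective_group_numbering =
  fixes \<G> :: "'g monoid set" and \<sigma> :: "'g monoid \<Rightarrow> nat" and tab :: "nat \<Rightarrow> nat list list"
  assumes finite_groups: "G \<in> \<G> \<Longrightarrow> group G \<and> finite (carrier G)"
    and representatives: "group_table T \<Longrightarrow> \<exists>!G. G \<in> \<G> \<and> mult_table G T"
    and bijection: "bij_betw \<sigma> \<G> UNIV"
    and number_from_table:
      "\<exists>p. \<forall>G\<in>\<G>. \<forall>T. mult_table G T \<longrightarrow> computes {} p [table_code T] (\<sigma> G)"
    and table_of_number: "mult_table (inv_into \<G> \<sigma> n) (tab n)"
    and table_from_number: "\<exists>p. \<forall>n. computes {} p [n] (table_code (tab n))"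


section \<open>The inverse Galois problem\<close>

text \<open>The minimal polynomial over \<open>F\<close> of every element of \<open>L\<close> splits in \<open>L\<close> (normality) and has only
  simple roots (separability; since the polynomial splits in \<open>L\<close>, roots outside \<open>L\<close> need not be
  considered).\<close>

definition galois_extension :: "('l, 'm) ring_scheme \<Rightarrow> 'l set \<Rightarrow> bool" where
  "galois_extension L F \<longleftrightarrow> field L \<and> subfield F L \<and>
    (\<forall>x\<in>carrier L. ring.algebraic L F x \<and> ring.splitted L (ring.Irr L F x) \<and>
      (\<forall>r\<in>carrier L. ring.alg_mult L (ring.Irr L F x) r \<le> 1))"

definition galois_group :: "('l, 'm) ring_scheme \<Rightarrow> 'l set \<Rightarrow> ('l \<Rightarrow> 'l) monoid" where
  "galois_group L F = BijGroup (carrier L)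
    \<lparr>carrier := {s \<in> Bij (carrier L). s \<in> ring_hom L L \<and> (\<forall>x\<in>F. s x = x)}\<rparr>"

text \<open>Taking \<open>L\<close> over the type \<open>'a list\<close> is no restriction: an extension of degree \<open>d\<close> has a copy
  whose elements are coordinate lists of length \<open>d\<close> over \<open>K\<close>. The embedding \<open>h\<close> (automatically
  injective) identifies \<open>K\<close> with a subfield of \<open>L\<close>.\<close>

definition IGP :: "('a, 'b) ring_scheme \<Rightarrow> ('g, 'm) monoid_scheme \<Rightarrow> bool" where
  "IGP K G \<longleftrightarrow> (\<exists>(L :: 'a list ring) h.
    h \<in> ring_hom K L \<and> galois_extension L (h ` carrier K) \<and>
    ring.dimension L (order G) (h ` carrier K) (carrier L) \<and>
    galois_group L (h ` carrier K) \<cong> G)"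

definition realized_groups ::
  "'g monoid set \<Rightarrow> ('g monoid \<Rightarrow> nat) \<Rightarrow> ('a, 'b) ring_scheme \<Rightarrow> nat \<Rightarrow> nat set" where
  "realized_groups \<G> \<sigma> K d = {n. order (inv_into \<G> \<sigma> n) = d \<and> IGP K (inv_into \<G> \<sigma> n)}"


section \<open>The sentences\<close>

definition effective_procedure :: "(nat list list \<Rightarrow> ring_formula) \<Rightarrow> bool" where
  "effective_procedure S \<longleftrightarrow>
    (\<exists>p. \<forall>T. group_table T \<longrightarrow> computes {} p [table_code T] (sentence_code (S T)))"

text \<open>The sentences must not depend on the field, but HOL cannot quantify over fields of all types
  inside an existential quantifier. The choice below is made once, by looking only at fields with
  carrier in \<open>nat\<close>, and so involves no type variable. That the chosen sentences exist, and that they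
  are correct for fields over every type, has to be proved.\<close>

definition igp_sentence :: "nat list list \<Rightarrow> ring_formula" where
  "igp_sentence = (SOME S. effective_procedure S \<and>
    (\<forall>(G :: nat monoid) T. group G \<longrightarrow> mult_table G T \<longrightarrow>
      sentence (S T) \<and> (\<forall>K :: nat ring. field K \<longrightarrow> (K \<Turnstile> S T \<longleftrightarrow> IGP K G))))"

end

(* For a finite group G of order n, a Galois extension of K with group G is encoded by finitely many
   elements of K: structure constants of an n-dimensional K-algebra L on K^n, the coordinates of its
   unit, and the n matrices of the operators by which G acts.  The sentence S(G) says that such data
   exist for which L is a field on which G acts faithfully by ring automorphisms.  No fixed field
   has to be mentioned: by Dedekind's independence of characters, at most [L:E] homomorphisms L -> L agree on
   a subfield E.  With E = K(x) this bounds the fibres of g |-> g x, so x has at least [K(x):K]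
   conjugates in L and its minimal polynomial splits with simple roots; with E = K it
   shows that every K-automorphism of L comes from G.

   The sentences chosen by SOME are only specified for fields on nat; they agree with S(G) in every
   field because every field has a countable elementary substructure. *)

theory Submission
  imports Defs
begin

section \<open>Characters and Galois extensions\<close>

text \<open>The degree is never stated in the sentence: a bilinear product on K^n has dimension n by
  construction, so quantifiers over n-tuples of K reach all of L, and addition and distributivity
  come for free. Normality and separability speak of the minimal polynomials of all elements; the
  counting argument trades them for the existence of n distinct operators. The bound on
  homomorphisms has to hold for maps that merely agree on the subfield E, since the operators in one
  fibre over x need not fix E = K(x). Two further obstacles shape the rest. The code of a term
  depends on the number of variables in scope, so computability of codes has to be tracked together
  with that number, and the multiplication table is read arithmetically from its own code to make
  the sentence a function of numbers. Also, the procedures are promised for the empty oracle but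
  have to run under the oracle Th(K); this is arranged by replacing their oracle calls by the
  constant 0.\<close>

lemma (in field) homogeneous_system_has_nontrivial_solution:
  fixes A :: "'i set"
  assumes "finite A" "m < card A" "\<And>j s. j < m \<Longrightarrow> s \<in> A \<Longrightarrow> M j s \<in> carrier R"
  shows "\<exists>a\<in>A \<rightarrow> carrier R. (\<exists>s\<in>A. a s \<noteq> \<zero>) \<and> (\<forall>j<m. (\<Oplus>s\<in>A. a s \<otimes> M j s) = \<zero>)"
  using assms
proof (induction m arbitrary: A M)
  case 0
  then have "A \<noteq> {}" by auto
  then show ?case by (intro bexI[of _ "\<lambda>_. \<one>"]) auto
next
  case (Suc m)
  note M = Suc.prems(3)
  show ?case
  proof (cases "\<forall>s\<in>A. M m s = \<zero>")
    case True
    from Suc.IH[of A M] Suc.prems obtain a where a: "a \<in> A \<rightarrow> carrier R" "\<exists>s\<in>A. a s \<noteq> \<zero>"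
      "\<forall>j<m. (\<Oplus>s\<in>A. a s \<otimes> M j s) = \<zero>" by auto
    have "(\<Oplus>s\<in>A. a s \<otimes> M m s) = (\<Oplus>s\<in>A. \<zero>)"
      using a(1) True by (intro finsum_cong') (auto simp: Pi_iff)
    with a show ?thesis by (intro bexI[of _ a]) (auto simp: less_Suc_eq)
  next
    case False
    then obtain t where t: "t \<in> A" "M m t \<noteq> \<zero>" by auto
    define B where "B = A - {t}"
    have B: "finite B" "t \<notin> B" "A = insert t B" "m < card B" using t Suc.prems by (auto simp: B_def)
    have Mt: "M m t \<in> carrier R" "inv M m t \<in> carrier R" "inv M m t \<otimes> M m t = \<one>"
      using M[of m t] t by (auto simp: field_Units)
    \<comment> \<open>Gaussian elimination with pivot \<open>M m t\<close>: adding
      \<open>q j\<close> times equation \<open>m\<close> to equation \<open>j\<close> removes the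
      unknown at \<open>t\<close>, which leaves \<open>m\<close> equations in the unknowns
      \<open>B\<close>.\<close>
    define q where "q j = \<ominus> (M j t \<otimes> inv M m t)" for j
    have q: "q j \<in> carrier R" if "j < Suc m" for j using that M t Mt by (auto simp: q_def)
    have "\<exists>a\<in>B \<rightarrow> carrier R. (\<exists>s\<in>B. a s \<noteq> \<zero>) \<and> (\<forall>j<m. (\<Oplus>s\<in>B. a s \<otimes> (M j s \<oplus> q j \<otimes> M m s)) = \<zero>)"
      using B M q by (intro Suc.IH) auto
    then obtain a where a: "a \<in> B \<rightarrow> carrier R" "\<exists>s\<in>B. a s \<noteq> \<zero>"
      "\<And>j. j < m \<Longrightarrow> (\<Oplus>s\<in>B. a s \<otimes> (M j s \<oplus> q j \<otimes> M m s)) = \<zero>" by blast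
    define Sg where "Sg j = (\<Oplus>s\<in>B. a s \<otimes> M j s)" for j
    have Sg: "Sg j \<in> carrier R" if "j < Suc m" for j
      unfolding Sg_def using that a(1) B M by (intro finsum_closed) auto
    \<comment> \<open>The value at \<open>t\<close> solves equation \<open>m\<close> for the pivot
      unknown; equation \<open>j\<close> then holds because it differs from its reduced form by a
      multiple of equation \<open>m\<close>.\<close>
    define b where "b = a(t := \<ominus> (inv M m t \<otimes> Sg m))"
    have b: "b \<in> A \<rightarrow> carrier R" using a(1) B Sg[of m] Mt by (auto simp: b_def)
    have "(\<Oplus>s\<in>A. b s \<otimes> M j s) = \<zero>" if j: "j < Suc m" for j
    proof -
      have Mj: "M j t \<in> carrier R" using M[of j t] t j by auto
      have "(\<Oplus>s\<in>A. b s \<otimes> M j s) = b t \<otimes> M j t \<oplus> (\<Oplus>s\<in>B. b s \<otimes> M j s)"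
        unfolding B(3) using B b M j by (intro finsum_insert) auto
      also have "(\<Oplus>s\<in>B. b s \<otimes> M j s) = Sg j"
        unfolding Sg_def using B a M j by (intro finsum_cong') (auto simp: b_def)
      also have "b t \<otimes> M j t = q j \<otimes> Sg m"
        unfolding b_def q_def using Sg[of m] Mj Mt by (simp add: l_minus r_minus m_ac)
      finally have *: "(\<Oplus>s\<in>A. b s \<otimes> M j s) = q j \<otimes> Sg m \<oplus> Sg j" .
      show ?thesis
      proof (cases "j = m")
        case True
        have "q m = \<ominus> \<one>" unfolding q_def using Mt by (simp add: m_comm)
        then show ?thesis using * True Sg[of m] by (simp add: l_minus l_neg)
      next
        case False
        then have jm: "j < m" using j by simp
        have "\<zero> = (\<Oplus>s\<in>B. a s \<otimes> M j s \<oplus> q j \<otimes> (a s \<otimes> M m s))"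
          unfolding a(3)[OF jm, symmetric] using a(1) B M j q[OF j]
          by (intro finsum_cong') (auto simp: r_distr m_ac Pi_iff)
        also have "\<dots> = Sg j \<oplus> (\<Oplus>s\<in>B. q j \<otimes> (a s \<otimes> M m s))"
          unfolding Sg_def using a(1) B M j q[OF j] by (intro finsum_addf) (auto simp: Pi_iff)
        also have "(\<Oplus>s\<in>B. q j \<otimes> (a s \<otimes> M m s)) = q j \<otimes> Sg m"
          unfolding Sg_def using a(1) B M q[OF j] by (intro finsum_rdistr[symmetric]) (auto simp: Pi_iff)
        finally show ?thesis using * Sg[of m] Sg[OF j] q[OF j] by (simp add: a_comm)
      qed
    qed
    moreover have "\<exists>s\<in>A. b s \<noteq> \<zero>" using a(2) B by (auto simp: b_def)
    ultimately show ?thesis using b by blast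
  qed
qed

text \<open>Take the relation at \<open>x \<otimes> y\<close> and subtract \<open>f t y\<close>
  times the relation at \<open>x\<close>: the term of \<open>t\<close> cancels, and a shorter
  relation with coefficients \<open>a s \<otimes> (f s y \<ominus> f t y)\<close> remains for the
  induction hypothesis. Choosing \<open>y\<close> where \<open>f s\<close> and \<open>f t\<close>
  differ makes the second factor nonzero.\<close>

lemma (in field) independence_of_characters:
  fixes A :: "'i set"
  assumes "finite A" "\<And>s. s \<in> A \<Longrightarrow> f s \<in> ring_hom R R"
    "\<And>s t. s \<in> A \<Longrightarrow> t \<in> A \<Longrightarrow> s \<noteq> t \<Longrightarrow> \<exists>x\<in>carrier R. f s x \<noteq> f t x"
    "a \<in> A \<rightarrow> carrier R" "\<And>x. x \<in> carrier R \<Longrightarrow> (\<Oplus>s\<in>A. a s \<otimes> f s x) = \<zero>"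
    "s \<in> A"
  shows "a s = \<zero>"
  using assms
proof (induction A arbitrary: a s rule: finite_induct)
  case (insert t A)
  note hom = insert.prems(1)
  have hc: "f s x \<in> carrier R" if "s \<in> insert t A" "x \<in> carrier R" for s x
    using ring_hom_closed[OF hom[OF that(1)] that(2)] .
  have a: "a s \<in> carrier R" if "s \<in> insert t A" for s using that insert.prems(3) by auto
  have split: "a t \<otimes> f t x \<oplus> (\<Oplus>s\<in>A. a s \<otimes> f s x) = \<zero>" if "x \<in> carrier R" for x
    using insert.prems(4)[OF that] finsum_insert[of A t "\<lambda>s. a s \<otimes> f s x"] insert.hyps a hc that
    by (auto simp: Pi_iff)
  have zero: "a s = \<zero>" if s: "s \<in> A" for s
  proof -
    obtain y where y: "y \<in> carrier R" "f s y \<noteq> f t y"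
      using insert.prems(2)[of s t] s insert.hyps by auto
    have "a s \<otimes> (f s y \<ominus> f t y) = \<zero>"
    proof (rule insert.IH[of "\<lambda>s. a s \<otimes> (f s y \<ominus> f t y)" s])
      show "(\<lambda>s. a s \<otimes> (f s y \<ominus> f t y)) \<in> A \<rightarrow> carrier R" using a hc y(1) by auto
      fix x assume x: "x \<in> carrier R"
      define S where "S z = (\<Oplus>s\<in>A. a s \<otimes> f s z)" for z
      have S: "S z \<in> carrier R" if "z \<in> carrier R" for z
        unfolding S_def using a hc that by (intro finsum_closed) auto
      note cl = S[OF x] S[OF m_closed[OF x y(1)]] a[OF insertI1] hc[OF insertI1 x] hc[OF insertI1 y(1)]
      have "(\<Oplus>s\<in>A. a s \<otimes> (f s y \<ominus> f t y) \<otimes> f s x)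
          = (\<Oplus>s\<in>A. a s \<otimes> f s (x \<otimes> y) \<oplus> \<ominus> f t y \<otimes> (a s \<otimes> f s x))"
      proof (rule finsum_cong')
        fix s assume s: "s \<in> A"
        have *: "f s (x \<otimes> y) = f s x \<otimes> f s y" using ring_hom_mult[OF hom x y(1)] s by auto
        show "a s \<otimes> (f s y \<ominus> f t y) \<otimes> f s x = a s \<otimes> f s (x \<otimes> y) \<oplus> \<ominus> f t y \<otimes> (a s \<otimes> f s x)"
          unfolding * using a[of s] hc[of s x] hc[of s y] hc[of t y] s x y
          by (simp add: a_minus_def r_distr l_distr l_minus r_minus m_ac)
      qed (use a hc x y in auto)
      also have "\<dots> = S (x \<otimes> y) \<oplus> (\<Oplus>s\<in>A. \<ominus> f t y \<otimes> (a s \<otimes> f s x))"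
        unfolding S_def using a hc x y by (intro finsum_addf) auto
      also have "(\<Oplus>s\<in>A. \<ominus> f t y \<otimes> (a s \<otimes> f s x)) = \<ominus> f t y \<otimes> S x"
        unfolding S_def using a hc x y insert.hyps by (intro finsum_rdistr[symmetric]) auto
      also have "S (x \<otimes> y) = \<ominus> (a t \<otimes> f t (x \<otimes> y))"
        using split[OF m_closed[OF x y(1)]] cl hc[OF insertI1 m_closed[OF x y(1)]]
        unfolding S_def[symmetric] by (intro minus_equality[symmetric]) (simp_all add: a_comm)
      also have "S x = \<ominus> (a t \<otimes> f t x)"
        using split[OF x] cl
        unfolding S_def[symmetric] by (intro minus_equality[symmetric]) (simp_all add: a_comm)
      also have "f t (x \<otimes> y) = f t x \<otimes> f t y" using ring_hom_mult[OF hom x y(1)] by auto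
      also have "\<ominus> (a t \<otimes> (f t x \<otimes> f t y)) \<oplus> \<ominus> f t y \<otimes> \<ominus> (a t \<otimes> f t x) = \<zero>"
        using cl by (simp add: l_minus r_minus l_neg m_ac)
      finally show "(\<Oplus>s\<in>A. a s \<otimes> (f s y \<ominus> f t y) \<otimes> f s x) = \<zero>" .
    qed (use insert.prems s in auto)
    moreover have "f s y \<ominus> f t y \<noteq> \<zero>" using y hc[of s y] hc[of t y] s by auto
    ultimately show ?thesis using integral[of "a s" "f s y \<ominus> f t y"] a[of s] hc[of s y] hc[of t y] s y(1) by auto
  qed
  \<comment> \<open>With all other coefficients zero, the relation at \<open>\<one>\<close> reduces
    to \<open>a t = \<zero>\<close>.\<close>
  have "(\<Oplus>s\<in>A. a s \<otimes> f s \<one>) = (\<Oplus>s\<in>A. \<zero>)"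
    using zero hc[of _ \<one>] by (intro finsum_cong') auto
  then have "a t = \<zero>"
    using split[of \<one>] a[of t] ring_hom_one[OF hom[of t]] by auto
  with zero insert.prems(5) show ?case by auto
qed simp

text \<open>More than \<open>d\<close> homomorphisms would satisfy a nontrivial relation on a base
  of \<open>R\<close> over \<open>F\<close>, which has only \<open>d\<close> vectors. Since the
  homomorphisms agree on \<open>F\<close>, the relation extends to the span of the base, against
  independence.\<close>

lemma (in field) card_homs_le_dimension:
  fixes A :: "'i set"
  assumes F: "subfield F R" and d: "dimension d F (carrier R)"
    and A: "finite A" "\<And>s. s \<in> A \<Longrightarrow> f s \<in> ring_hom R R"
    "\<And>s t. s \<in> A \<Longrightarrow> t \<in> A \<Longrightarrow> s \<noteq> t \<Longrightarrow> \<exists>x\<in>carrier R. f s x \<noteq> f t x"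
    and agree: "\<And>s t k. s \<in> A \<Longrightarrow> t \<in> A \<Longrightarrow> k \<in> F \<Longrightarrow> f s k = f t k"
  shows "card A \<le> d"
proof (rule ccontr)
  assume "\<not> card A \<le> d"
  then have less: "d < card A" by simp
  obtain Vs where Vs: "set Vs \<subseteq> carrier R" "length Vs = d" "Span F Vs = carrier R"
    using exists_base[OF F d] by blast
  have hc: "f s x \<in> carrier R" if "s \<in> A" "x \<in> carrier R" for s x
    using ring_hom_closed[OF A(2)[OF that(1)] that(2)] .
  have Vsc: "Vs ! j \<in> carrier R" if "j < d" for j using Vs that by auto
  have "\<exists>a\<in>A \<rightarrow> carrier R. (\<exists>s\<in>A. a s \<noteq> \<zero>) \<and> (\<forall>j<d. (\<Oplus>s\<in>A. a s \<otimes> f s (Vs ! j)) = \<zero>)"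
    using less A Vsc hc by (intro homogeneous_system_has_nontrivial_solution) auto
  then obtain a where a: "a \<in> A \<rightarrow> carrier R" "\<exists>s\<in>A. a s \<noteq> \<zero>"
    "\<And>j. j < d \<Longrightarrow> (\<Oplus>s\<in>A. a s \<otimes> f s (Vs ! j)) = \<zero>" by blast
  define S where "S x = (\<Oplus>s\<in>A. a s \<otimes> f s x)" for x
  have Fc: "F \<subseteq> carrier R" using subfieldE(3)[OF F] .
  have Span0: "set Us \<subseteq> carrier R \<Longrightarrow> (\<forall>v\<in>set Us. S v = \<zero>) \<Longrightarrow> x \<in> Span F Us \<Longrightarrow> x \<in> carrier R \<and> S x = \<zero>" for Us x
  proof (induction Us arbitrary: x)
    case Nil
    then have x: "x = \<zero>" by simp
    have h0: "f s \<zero> = \<zero>" if "s \<in> A" for s using ring_hom_zero[OF A(2)[OF that]] ring_axioms by auto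
    have "S x = (\<Oplus>s\<in>A. \<zero>)" unfolding S_def x using h0 a(1) by (intro finsum_cong') (auto simp: Pi_iff)
    then show ?case using x by simp
  next
    case (Cons v Us)
    then obtain k w where kw: "k \<in> F" "w \<in> Span F Us" "x = k \<otimes> v \<oplus> w"
      by (auto simp: line_extension_mem_iff)
    have c: "v \<in> carrier R" "k \<in> carrier R" "w \<in> carrier R" "S w = \<zero>" "S v = \<zero>"
      using Cons kw Fc by auto
    \<comment> \<open>By \<open>agree\<close>, \<open>f s k\<close> has the same value
      \<open>f s0 k\<close> for every \<open>s\<close>, so it can be pulled out of the sum.\<close>
    obtain s0 where s0: "s0 \<in> A" using a(2) by auto
    have "S x = (\<Oplus>s\<in>A. f s0 k \<otimes> (a s \<otimes> f s v) \<oplus> a s \<otimes> f s w)"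
      unfolding S_def
    proof (rule finsum_cong')
      fix s assume s: "s \<in> A"
      have "f s x = f s0 k \<otimes> f s v \<oplus> f s w"
        unfolding kw(3) using ring_hom_add[OF A(2)[OF s]] ring_hom_mult[OF A(2)[OF s]] c
          agree[OF s s0 kw(1)] by simp
      then show "a s \<otimes> f s x = f s0 k \<otimes> (a s \<otimes> f s v) \<oplus> a s \<otimes> f s w"
        using a(1) s s0 hc c by (simp add: r_distr m_ac Pi_iff)
    qed (use a(1) hc c s0 in \<open>auto simp: Pi_iff\<close>)
    also have "\<dots> = (\<Oplus>s\<in>A. f s0 k \<otimes> (a s \<otimes> f s v)) \<oplus> S w"
      unfolding S_def using a(1) hc c s0 by (intro finsum_addf) (auto simp: Pi_iff)
    also have "(\<Oplus>s\<in>A. f s0 k \<otimes> (a s \<otimes> f s v)) = f s0 k \<otimes> S v"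
      unfolding S_def using a(1) hc c s0 A(1) by (intro finsum_rdistr[symmetric]) (auto simp: Pi_iff)
    finally show ?case using c hc[OF s0] kw by simp
  qed
  have "\<forall>v\<in>set Vs. S v = \<zero>" using a(3) Vs(2) by (auto simp: S_def in_set_conv_nth)
  then have S0: "S x = \<zero>" if "x \<in> carrier R" for x
    using Span0[OF Vs(1)] that unfolding Vs(3) by blast
  have "a s = \<zero>" if "s \<in> A" for s
    by (rule independence_of_characters[OF A(1) A(2) A(3) a(1) S0[unfolded S_def] that])
  with a(2) show False by blast
qed


text \<open>Both halves of the Galois property come out of one squeeze. If \<open>r\<close> is the
  degree of the minimal polynomial of \<open>x\<close>, then \<open>r\<close> \<le> number of
  conjugates of \<open>x\<close> \<le> number of distinct roots \<le> number of roots with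
  multiplicity \<le> \<open>r\<close>, so equality holds throughout.\<close>

lemma (in field) enough_homs_imp_galois:
  fixes A :: "'i set"
  assumes F: "subfield F R" and n: "dimension (card A) F (carrier R)"
    and A: "finite A" "A \<noteq> {}" "\<And>s. s \<in> A \<Longrightarrow> f s \<in> ring_hom R R"
    "\<And>s t. s \<in> A \<Longrightarrow> t \<in> A \<Longrightarrow> s \<noteq> t \<Longrightarrow> \<exists>x\<in>carrier R. f s x \<noteq> f t x"
    and fix_F: "\<And>s k. s \<in> A \<Longrightarrow> k \<in> F \<Longrightarrow> f s k = k"
  shows "galois_extension R F"
  unfolding galois_extension_def
proof (intro conjI ballI)
  show "field R" by (rule field_axioms)
  show "subfield F R" by fact
  fix x assume x: "x \<in> carrier R"
  have hc: "f s x \<in> carrier R" if "s \<in> A" "x \<in> carrier R" for s x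
    using ring_hom_closed[OF A(3)[OF that(1)] that(2)] .
  have Fc: "F \<subseteq> carrier R" using subfieldE(3)[OF F] .
  have fin: "finite_dimension F (carrier R)" using n by (rule finite_dimensionI)
  have alg: "(algebraic over F) x"
    using finite_dimension_imp_algebraic[OF F carrier_is_subring fin x] .
  then show "algebraic F x" by (simp add: over_def)
  define E where "E = simple_extension F x"
  have E: "subfield E R" using simple_extension_is_subfield[OF F x] alg by (simp add: E_def)
  define p where "p = Irr F x"
  define r where "r = degree p"
  have p: "p \<in> carrier (F[X])" "eval p x = \<zero>" "p \<noteq> []" "p \<in> carrier (poly_ring R)"
  proof -
    show *: "p \<in> carrier (F[X])" "eval p x = \<zero>" using IrrE[OF F x alg] by (auto simp: p_def)
    show "p \<noteq> []"
      using IrrE(2)[OF F x alg] * unfolding p_def ring_irreducible_def by (auto simp: univ_poly_zero)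
    show "p \<in> carrier (poly_ring R)" using * carrier_polynomial_shell[OF subfieldE(1)[OF F]] by auto
  qed
  have dimE: "dimension r F E" using dimension_simple_extension[OF F x alg] by (simp add: E_def p_def r_def)
  obtain Vs where Vs: "set Vs \<subseteq> carrier R" "Span F Vs = carrier R"
    using exists_base[OF F n] by blast
  \<comment> \<open>A spanning list over \<open>F\<close> still spans over the larger field
    \<open>E\<close>; this gives the finite degree \<open>d\<close> of \<open>R\<close> over
    \<open>E\<close> that the tower law multiplies with \<open>r\<close>.\<close>
  have "Span E Vs = carrier R"
  proof
    show "Span E Vs \<subseteq> carrier R" using Span_in_carrier[OF _ Vs(1)] subfieldE(3)[OF E] by auto
    have "F \<subseteq> E" using simple_extension_incl[OF Fc x] by (simp add: E_def)
    then show "carrier R \<subseteq> Span E Vs"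
      unfolding Vs(2)[symmetric] Span_eq_combine_set[OF F Vs(1)] Span_eq_combine_set[OF E Vs(1)] by auto
  qed
  then have finE: "finite_dimension E (carrier R)" using Span_finite_dimension[OF E Vs(1)] by simp
  then obtain d where d: "dimension d E (carrier R)" by blast
  have card: "card A = r * d"
    using telescopic_base[OF F E dimE d] dimension_is_inj[OF F n] by blast
  define Orb where "Orb = (\<lambda>s. f s x) ` A"
  have finOrb: "finite Orb" using A(1) by (simp add: Orb_def)
  \<comment> \<open>Homomorphisms with the same value at \<open>x\<close> agree on \<open>F\<close>
    and at \<open>x\<close>, hence on all of \<open>E\<close>.\<close>
  have fibre: "card {s \<in> A. f s x = y} \<le> d" for y
  proof (rule card_homs_le_dimension[OF E d])
    fix s t k assume st: "s \<in> {s \<in> A. f s x = y}" "t \<in> {s \<in> A. f s x = y}" and k: "k \<in> E"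
    show "f s k = f t k" using k unfolding E_def
    proof (induction k rule: simple_extension.induct)
      case zero
      then show ?case using st ring_hom_zero[OF A(3) ring_axioms ring_axioms] by auto
    next
      \<comment> \<open>Elements of the simple extension are built in Horner form
        \<open>k1 \<otimes> x \<oplus> k2\<close>, with \<open>k1\<close> already built and
        \<open>k2\<close> in \<open>F\<close>.\<close>
      case (lin k1 k2)
      have c: "k1 \<in> carrier R" "k2 \<in> carrier R"
        using lin simple_extension_in_carrier[OF Fc x] Fc by auto
      show ?case using st lin c x ring_hom_add[OF A(3)] ring_hom_mult[OF A(3)] fix_F by auto
    qed
  qed (use A in auto)
  have "card A = card (\<Union>y\<in>Orb. {s \<in> A. f s x = y})" by (rule arg_cong[of _ _ card]) (auto simp: Orb_def)
  also have "\<dots> \<le> (\<Sum>y\<in>Orb. card {s \<in> A. f s x = y})" using finOrb by (rule card_UN_le)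
  also have "\<dots> \<le> card Orb * d" using sum_bounded_above[of Orb "\<lambda>y. card {s \<in> A. f s x = y}" d] fibre by simp
  finally have "r * d \<le> card Orb * d" using card by simp
  moreover have "d > 0" using card A by (cases d) auto
  ultimately have rOrb: "r \<le> card Orb" by simp
  have "Orb \<subseteq> set_mset (roots p)"
  proof
    fix y assume "y \<in> Orb"
    then obtain s where s: "s \<in> A" "y = f s x" by (auto simp: Orb_def)
    interpret s: ring_hom_ring R R "f s" using A(3)[OF s(1)] by (intro ring_hom_ringI2 ring_axioms)
    \<comment> \<open>The coefficients of \<open>p\<close> lie in \<open>F\<close> and are fixed by
      \<open>f s\<close>, which therefore maps roots of \<open>p\<close> to roots of
      \<open>p\<close>.\<close>
    have "map (f s) p = p"
      using p(1) fix_F[OF s(1)] by (intro map_idI) (auto simp: univ_poly_def polynomial_def)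
    then have "eval p y = f s (eval p x)"
      using s.eval_hom[OF carrier_is_subring x p(4)] s by simp
    then show "y \<in># roots p" using s p x hc roots_mem_iff_is_root[OF p(4)] by (simp add: is_root_def)
  qed
  then have "card Orb \<le> card (set_mset (roots p))" by (intro card_mono) auto
  moreover have "card (set_mset (roots p)) \<le> size (roots p)"
    using sum_mono[of "set_mset (roots p)" "\<lambda>_. 1" "count (roots p)"]
    by (simp add: size_multiset_overloaded_eq Suc_le_eq)
  moreover have "size (roots p) \<le> r" using size_roots_le_degree[OF p(4)] by (simp add: r_def)
  ultimately have eq: "size (roots p) = r" "card (set_mset (roots p)) = size (roots p)" using rOrb by auto
  from eq(1) show "splitted (Irr F x)" by (simp add: splitted_def p_def r_def)
  fix y assume "y \<in> carrier R"
  have "count (roots p) y \<le> 1"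
  proof (rule ccontr)
    assume *: "\<not> count (roots p) y \<le> 1"
    then have "y \<in># roots p" by (metis not_in_iff zero_le)
    then have "card (set_mset (roots p)) < size (roots p)"
      using sum_strict_mono_ex1[of "set_mset (roots p)" "\<lambda>_. 1" "count (roots p)"] *
      by (force simp: size_multiset_overloaded_eq Suc_le_eq)
    with eq show False by simp
  qed
  then show "alg_mult (Irr F x) y \<le> 1" using alg_mult_eq_count_roots[OF p(4)] by (simp add: p_def)
qed

text \<open>Otherwise \<open>g\<close>, adjoined under the new index \<open>None\<close>, would give
  \<open>card A + 1\<close> distinct homomorphisms agreeing on \<open>F\<close>, one more than the
  degree allows.\<close>

lemma (in field) hom_in_full_family:
  fixes A :: "'i set"
  assumes F: "subfield F R" and n: "dimension (card A) F (carrier R)"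
    and A: "finite A" "\<And>s. s \<in> A \<Longrightarrow> f s \<in> ring_hom R R"
    "\<And>s t. s \<in> A \<Longrightarrow> t \<in> A \<Longrightarrow> s \<noteq> t \<Longrightarrow> \<exists>x\<in>carrier R. f s x \<noteq> f t x"
    and fix_F: "\<And>s k. s \<in> A \<Longrightarrow> k \<in> F \<Longrightarrow> f s k = k"
    and g: "g \<in> ring_hom R R" "\<And>k. k \<in> F \<Longrightarrow> g k = k"
  shows "\<exists>s\<in>A. \<forall>x\<in>carrier R. g x = f s x"
proof (rule ccontr)
  assume not: "\<not> ?thesis"
  define h where "h = case_option g f"
  have "card (insert None (Some ` A)) \<le> card A"
  proof (rule card_homs_le_dimension[OF F n, where f = h])
    fix s t assume *: "s \<in> insert None (Some ` A)" "t \<in> insert None (Some ` A)" "s \<noteq> t"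
    show "\<exists>x\<in>carrier R. h s x \<noteq> h t x"
      using * not A(3) by (auto simp: h_def) (metis A(3))+
  qed (use A g fix_F in \<open>auto simp: h_def\<close>)
  moreover have "card (insert None (Some ` A)) = Suc (card A)"
    using A(1) by (subst card_insert_disjoint) (auto simp: card_image)
  ultimately show False by simp
qed


section \<open>The sentence\<close>

primrec tsum :: "nat \<Rightarrow> (nat \<Rightarrow> ring_term) \<Rightarrow> ring_term" where
  "tsum 0 f = TZero"
| "tsum (Suc m) f = TAdd (f m) (tsum m f)"

primrec conjs :: "nat \<Rightarrow> (nat \<Rightarrow> ring_formula) \<Rightarrow> ring_formula" where
  "conjs 0 f = Equal TZero TZero"
| "conjs (Suc m) f = Conj (conjs m f) (f m)"

primrec exs :: "nat \<Rightarrow> ring_formula \<Rightarrow> ring_formula" where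
  "exs 0 \<phi> = \<phi>"
| "exs (Suc m) \<phi> = Ex (exs m \<phi>)"

definition alls :: "nat \<Rightarrow> ring_formula \<Rightarrow> ring_formula" where
  "alls m \<phi> = Neg (exs m (Neg \<phi>))"

definition disj :: "ring_formula \<Rightarrow> ring_formula \<Rightarrow> ring_formula" where
  "disj \<phi> \<psi> = Neg (Conj (Neg \<phi>) (Neg \<psi>))"

text \<open>Folded in the same order as \<open>tsum\<close>, so that evaluating a term sum yields a
  \<open>vsum\<close> literally, before any ring law is available.\<close>

primrec vsum :: "('a, 'b) ring_scheme \<Rightarrow> nat \<Rightarrow> (nat \<Rightarrow> 'a) \<Rightarrow> 'a" where
  "vsum K 0 f = \<zero>\<^bsub>K\<^esub>"
| "vsum K (Suc m) f = f m \<oplus>\<^bsub>K\<^esub> vsum K m f"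

lemma vsum_cong: "m = m' \<Longrightarrow> (\<And>i. i < m' \<Longrightarrow> f i = g i) \<Longrightarrow> vsum K m f = vsum K m' g"
  by (induction m arbitrary: m') auto

lemma term_val_tsum: "term_val K e (tsum m f) = vsum K m (\<lambda>i. term_val K e (f i))"
  by (induction m) auto

lemma satisfies_conjs: "satisfies K e (conjs m f) \<longleftrightarrow> (\<forall>i<m. satisfies K e (f i))"
  by (induction m) (auto simp: less_Suc_eq)

definition vectors :: "('a, 'b) ring_scheme \<Rightarrow> nat \<Rightarrow> 'a list set" where
  "vectors K n = {x. length x = n \<and> set x \<subseteq> carrier K}"

lemma satisfies_exs: "satisfies K e (exs m \<phi>) \<longleftrightarrow> (\<exists>v\<in>vectors K m. satisfies K (v @ e) \<phi>)"
proof (induction m arbitrary: e)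
  case 0
  then show ?case by (simp add: vectors_def)
next
  case (Suc m)
  show ?case
  proof
    assume "satisfies K e (exs (Suc m) \<phi>)"
    \<comment> \<open>The outermost quantifier of the block is read first, so its value
      \<open>x\<close> ends up behind the others, as the last entry of the block.\<close>
    then obtain x v where "x \<in> carrier K" "v \<in> vectors K m" "satisfies K (v @ x # e) \<phi>"
      using Suc by auto
    then show "\<exists>v\<in>vectors K (Suc m). satisfies K (v @ e) \<phi>"
      by (intro bexI[of _ "v @ [x]"]) (auto simp: vectors_def)
  next
    assume "\<exists>v\<in>vectors K (Suc m). satisfies K (v @ e) \<phi>"
    then obtain v where v: "v \<in> vectors K (Suc m)" "satisfies K (v @ e) \<phi>" by blast
    then have "v \<noteq> []" by (auto simp: vectors_def)
    then obtain w x where "v = w @ [x]" by (metis rev_exhaust)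
    with v show "satisfies K e (exs (Suc m) \<phi>)"
      using Suc by (auto simp: vectors_def)
  qed
qed

lemma satisfies_alls: "satisfies K e (alls m \<phi>) \<longleftrightarrow> (\<forall>v\<in>vectors K m. satisfies K (v @ e) \<phi>)"
  by (simp add: alls_def satisfies_exs)

lemma satisfies_disj: "satisfies K e (disj \<phi> \<psi>) \<longleftrightarrow> satisfies K e \<phi> \<or> satisfies K e \<psi>"
  by (simp add: disj_def)

text \<open>A vector of terms is a function, of which the first \<open>n\<close> values count.\<close>

definition tvec :: "('a, 'b) ring_scheme \<Rightarrow> 'a list \<Rightarrow> nat \<Rightarrow> (nat \<Rightarrow> ring_term) \<Rightarrow> 'a list" where
  "tvec K e n t = map (\<lambda>k. term_val K e (t k)) [0..<n]"

definition veq :: "nat \<Rightarrow> (nat \<Rightarrow> ring_term) \<Rightarrow> (nat \<Rightarrow> ring_term) \<Rightarrow> ring_formula" where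
  "veq n s t = conjs n (\<lambda>k. Equal (s k) (t k))"

lemma satisfies_veq: "satisfies K e (veq n s t) \<longleftrightarrow> tvec K e n s = tvec K e n t"
  by (auto simp: veq_def tvec_def satisfies_conjs)

section \<open>Vectors, products and operators in coordinates\<close>

definition vec_at :: "nat \<Rightarrow> nat \<Rightarrow> ring_term" where
  "vec_at b = (\<lambda>k. TVar (b + k))"

definition zero_terms :: "nat \<Rightarrow> ring_term" where
  "zero_terms = (\<lambda>k. TZero)"

definition mat_at :: "nat \<Rightarrow> nat \<Rightarrow> nat \<Rightarrow> nat \<Rightarrow> nat \<Rightarrow> ring_term" where
  "mat_at n b = (\<lambda>i j k. TVar (b + ((i * n + j) * n + k)))"

text \<open>The bilinear product on \<open>K^n\<close> with structure constants \<open>c\<close>: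
  \<open>c i j k\<close> is coordinate \<open>k\<close> of the product of the basis vectors
  \<open>i\<close> and \<open>j\<close>. Summing over \<open>i\<close> inside makes the product
  visibly linear in \<open>t\<close> for fixed \<open>s\<close>.\<close>

definition tmul :: "nat \<Rightarrow> (nat \<Rightarrow> nat \<Rightarrow> nat \<Rightarrow> ring_term) \<Rightarrow> (nat \<Rightarrow> ring_term) \<Rightarrow> (nat \<Rightarrow> ring_term) \<Rightarrow> nat \<Rightarrow> ring_term" where
  "tmul n c s t = (\<lambda>k. tsum n (\<lambda>j. TMul (tsum n (\<lambda>i. TMul (s i) (c i j k))) (t j)))"

text \<open>A row vector times the matrix \<open>a g\<close>, whose row \<open>i\<close> is the
  image of the basis vector \<open>i\<close>.\<close>

definition tapp :: "nat \<Rightarrow> (nat \<Rightarrow> nat \<Rightarrow> nat \<Rightarrow> ring_term) \<Rightarrow> nat \<Rightarrow> (nat \<Rightarrow> ring_term) \<Rightarrow> nat \<Rightarrow> ring_term" where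
  "tapp n a g s = (\<lambda>k. tsum n (\<lambda>i. TMul (s i) (a g i k)))"

definition vmul :: "('a, 'b) ring_scheme \<Rightarrow> nat \<Rightarrow> (nat \<Rightarrow> nat \<Rightarrow> nat \<Rightarrow> 'a) \<Rightarrow> 'a list \<Rightarrow> 'a list \<Rightarrow> 'a list" where
  "vmul K n c x y =
    map (\<lambda>k. vsum K n (\<lambda>j. vsum K n (\<lambda>i. x ! i \<otimes>\<^bsub>K\<^esub> c i j k) \<otimes>\<^bsub>K\<^esub> y ! j)) [0..<n]"

definition vapp :: "('a, 'b) ring_scheme \<Rightarrow> nat \<Rightarrow> (nat \<Rightarrow> nat \<Rightarrow> nat \<Rightarrow> 'a) \<Rightarrow> nat \<Rightarrow> 'a list \<Rightarrow> 'a list" where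
  "vapp K n a g x = map (\<lambda>k. vsum K n (\<lambda>i. x ! i \<otimes>\<^bsub>K\<^esub> a g i k)) [0..<n]"

lemma tvec_tmul:
  "tvec K e n (tmul n c s t) =
    vmul K n (\<lambda>i j k. term_val K e (c i j k)) (tvec K e n s) (tvec K e n t)"
  by (auto simp: tvec_def tmul_def vmul_def term_val_tsum intro!: vsum_cong arg_cong2[of _ _ _ _ "\<lambda>x y. x \<otimes>\<^bsub>K\<^esub> y"])

lemma tvec_tapp:
  "tvec K e n (tapp n a g s) = vapp K n (\<lambda>i j k. term_val K e (a i j k)) g (tvec K e n s)"
  by (auto simp: tvec_def tapp_def vapp_def term_val_tsum intro!: vsum_cong)

lemma tvec_zero: "tvec K e n zero_terms = replicate n \<zero>\<^bsub>K\<^esub>"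
  by (simp add: tvec_def zero_terms_def map_replicate_const)

lemma tvec_vec_at: "length v = b \<Longrightarrow> length x = n \<Longrightarrow> tvec K (v @ x @ w) n (vec_at b) = x"
  by (auto simp: tvec_def vec_at_def nth_append intro!: nth_equalityI)

text \<open>Row-major reading of a list of length \<open>n * n * n\<close>, the layout in which
  \<open>mat_at\<close> places the variables.\<close>

definition mat_of :: "nat \<Rightarrow> 'a list \<Rightarrow> nat \<Rightarrow> nat \<Rightarrow> nat \<Rightarrow> 'a" where
  "mat_of n P = (\<lambda>i j k. P ! ((i * n + j) * n + k))"

lemma index_less: "i < m \<Longrightarrow> j < n \<Longrightarrow> i * n + j < m * (n::nat)"
  by (metis add_less_cancel_left less_le_trans mult_Suc add.commute mult_le_mono1 Suc_leI)

lemma term_val_mat_at: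
  assumes "length v = b" "length P = n * n * n" "i < n" "j < n" "k < n"
  shows "term_val K (v @ P @ w) (mat_at n b i j k) = mat_of n P i j k"
proof -
  have "(i * n + j) * n + k < length P"
    unfolding assms(2) using assms(3-5) by (intro index_less) auto
  then show ?thesis using assms(1) by (simp add: mat_at_def mat_of_def nth_append)
qed

lemma vmul_cong: "(\<And>i j k. i < n \<Longrightarrow> j < n \<Longrightarrow> k < n \<Longrightarrow> c i j k = c' i j k) \<Longrightarrow> vmul K n c = vmul K n c'"
  by (auto simp: vmul_def fun_eq_iff intro!: vsum_cong arg_cong2[of _ _ _ _ "\<lambda>x y. x \<otimes>\<^bsub>K\<^esub> y"])

lemma vapp_cong: "(\<And>i k. i < n \<Longrightarrow> k < n \<Longrightarrow> a g i k = a' g i k) \<Longrightarrow> vapp K n a g = vapp K n a' g"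
  by (auto simp: vapp_def fun_eq_iff intro!: vsum_cong)

lemma ex_mat_of:
  assumes "\<And>i j k. i < n \<Longrightarrow> j < n \<Longrightarrow> k < n \<Longrightarrow> c i j k \<in> carrier K"
  shows "\<exists>C\<in>vectors K (n * n * n). \<forall>i<n. \<forall>j<n. \<forall>k<n. mat_of n C i j k = c i j k"
proof
  \<comment> \<open>The index triple belonging to position \<open>m\<close> consists of its digits
    in base \<open>n\<close>.\<close>
  let ?C = "map (\<lambda>m. c (m div n div n) (m div n mod n) (m mod n)) [0..<n * n * n]"
  have "m div n div n < n" "m div n mod n < n" "m mod n < n" if "m < n * n * n" for m
  proof -
    have "n > 0" using that by (cases "n = 0") auto
    then show "m div n div n < n" "m div n mod n < n" "m mod n < n"
      using that by (auto simp: less_mult_imp_div_less)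
  qed
  then show "?C \<in> vectors K (n * n * n)" using assms by (auto simp: vectors_def)
  show "\<forall>i<n. \<forall>j<n. \<forall>k<n. mat_of n ?C i j k = c i j k"
  proof (intro allI impI)
    fix i j k assume ijk: "i < n" "j < n" "k < n"
    have "(i * n + j) * n + k < n * n * n" using ijk by (intro index_less) auto
    then show "mat_of n ?C i j k = c i j k" using ijk by (simp add: mat_of_def)
  qed
qed

text \<open>Free variables, from index 0 on: the three vectors that are quantified innermost, then the unit, the
  matrices of the group action and the structure constants. In \<open>inverse_axiom\<close> only two vectors
  precede the unit.\<close>

definition data_axioms :: "nat \<Rightarrow> (nat \<Rightarrow> nat \<Rightarrow> nat) \<Rightarrow> ring_formula" where
  "data_axioms n lk =
    (let x = vec_at 0; y = vec_at n; z = vec_at (n + n);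
         u = vec_at (n + n + n); a = mat_at n (n + n + n + n); c = mat_at n (n + n + n + n + n * n * n) in
      Conj (veq n (tmul n c (tmul n c x y) z) (tmul n c x (tmul n c y z)))
     (Conj (veq n (tmul n c x y) (tmul n c y x))
     (Conj (veq n (tmul n c u x) x)
     (Conj (conjs n (\<lambda>g. veq n (tapp n a g (tmul n c x y)) (tmul n c (tapp n a g x) (tapp n a g y))))
     (Conj (conjs n (\<lambda>g. veq n (tapp n a g u) u))
           (conjs n (\<lambda>g. conjs n (\<lambda>h. veq n (tapp n a g (tapp n a h x)) (tapp n a (lk g h) x)))))))))"

definition inverse_axiom :: "nat \<Rightarrow> ring_formula" where
  "inverse_axiom n =
    disj (veq n (vec_at n) zero_terms)
         (veq n (tmul n (mat_at n (n + n + n + n * n * n)) (vec_at n) (vec_at 0)) (vec_at (n + n)))"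

text \<open>The group enters only through \<open>lk\<close>, which tells which operator a composite
  of two operators must be. The structure constants are quantified first and so lie at the end of
  the environment, behind the matrices and the unit; the offsets of the cubes therefore vary with
  the number of vectors bound further inside. Distinctness of the operators is symmetric, so pairs
  \<open>h < g\<close> suffice.\<close>

definition igp_formula :: "nat \<Rightarrow> (nat \<Rightarrow> nat \<Rightarrow> nat) \<Rightarrow> ring_formula" where
  "igp_formula n lk =
    exs (n * n * n) (exs (n * n * n) (exs n
      (Conj (alls n (alls n (alls n (data_axioms n lk))))
      (Conj (Neg (veq n (vec_at 0) zero_terms))
      (Conj (alls n (exs n (inverse_axiom n)))
            (conjs n (\<lambda>g. conjs g (\<lambda>h. exs n (Neg (veq n
              (tapp n (mat_at n (n + n)) g (vec_at 0)) (tapp n (mat_at n (n + n)) h (vec_at 0))))))))))))"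

text \<open>Kept parallel to \<open>igp_formula\<close>, down to the order of the quantifiers and
  the disjunction under the existential, so that the two can be matched conjunct by conjunct. The
  unit law on one side is enough because commutativity is among the conditions.\<close>

definition galois_data :: "('a, 'b) ring_scheme \<Rightarrow> nat \<Rightarrow> (nat \<Rightarrow> nat \<Rightarrow> nat) \<Rightarrow>
    (nat \<Rightarrow> nat \<Rightarrow> nat \<Rightarrow> 'a) \<Rightarrow> (nat \<Rightarrow> nat \<Rightarrow> nat \<Rightarrow> 'a) \<Rightarrow> 'a list \<Rightarrow> bool" where
  "galois_data K n lk c a u \<longleftrightarrow>
    (\<forall>z\<in>vectors K n. \<forall>y\<in>vectors K n. \<forall>x\<in>vectors K n.
      vmul K n c (vmul K n c x y) z = vmul K n c x (vmul K n c y z) \<and>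
      vmul K n c x y = vmul K n c y x \<and>
      vmul K n c u x = x \<and>
      (\<forall>g<n. vapp K n a g (vmul K n c x y) = vmul K n c (vapp K n a g x) (vapp K n a g y)) \<and>
      (\<forall>g<n. vapp K n a g u = u) \<and>
      (\<forall>g<n. \<forall>h<n. vapp K n a g (vapp K n a h x) = vapp K n a (lk g h) x)) \<and>
    u \<noteq> replicate n \<zero>\<^bsub>K\<^esub> \<and>
    (\<forall>x\<in>vectors K n. \<exists>y\<in>vectors K n. x = replicate n \<zero>\<^bsub>K\<^esub> \<or> vmul K n c x y = u) \<and>
    (\<forall>g<n. \<forall>h<g. \<exists>x\<in>vectors K n. vapp K n a g x \<noteq> vapp K n a h x)"

lemma tvec_tmul_mat_at:
  assumes "length v = b" "length C = n * n * n"
  shows "tvec K (v @ C @ w) n (tmul n (mat_at n b) s t)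
    = vmul K n (mat_of n C) (tvec K (v @ C @ w) n s) (tvec K (v @ C @ w) n t)"
  unfolding tvec_tmul using assms
  by (subst vmul_cong[where c' = "mat_of n C"]) (simp_all add: term_val_mat_at)

lemma tvec_tapp_mat_at:
  assumes "length v = b" "length A = n * n * n" "g < n"
  shows "tvec K (v @ A @ w) n (tapp n (mat_at n b) g s)
    = vapp K n (mat_of n A) g (tvec K (v @ A @ w) n s)"
  unfolding tvec_tapp using assms
  by (subst vapp_cong[where a' = "mat_of n A"]) (simp_all add: term_val_mat_at)

text \<open>Each conjunct is evaluated by locating its vectors and cubes in the environment. The
  bound on \<open>lk\<close> keeps the selected operator inside the block of variables that holds
  the matrices.\<close>

lemma models_igp_formula:
  assumes lk: "\<And>g h. g < n \<Longrightarrow> h < n \<Longrightarrow> lk g h < n"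
  shows "K \<Turnstile> igp_formula n lk \<longleftrightarrow>
    (\<exists>C\<in>vectors K (n * n * n). \<exists>A\<in>vectors K (n * n * n). \<exists>u\<in>vectors K n.
      galois_data K n lk (mat_of n C) (mat_of n A) u)"
proof -
  have data: "satisfies K (x @ y @ z @ u @ A @ C) (data_axioms n lk) \<longleftrightarrow>
      vmul K n (mat_of n C) (vmul K n (mat_of n C) x y) z = vmul K n (mat_of n C) x (vmul K n (mat_of n C) y z) \<and>
      vmul K n (mat_of n C) x y = vmul K n (mat_of n C) y x \<and>
      vmul K n (mat_of n C) u x = x \<and>
      (\<forall>g<n. vapp K n (mat_of n A) g (vmul K n (mat_of n C) x y)
        = vmul K n (mat_of n C) (vapp K n (mat_of n A) g x) (vapp K n (mat_of n A) g y)) \<and>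
      (\<forall>g<n. vapp K n (mat_of n A) g u = u) \<and>
      (\<forall>g<n. \<forall>h<n. vapp K n (mat_of n A) g (vapp K n (mat_of n A) h x) = vapp K n (mat_of n A) (lk g h) x)"
    if C: "C \<in> vectors K (n * n * n)" and A: "A \<in> vectors K (n * n * n)" and u: "u \<in> vectors K n"
      and x: "x \<in> vectors K n" and y: "y \<in> vectors K n" and z: "z \<in> vectors K n" for x y z u A C
  proof -
    define e where "e = x @ y @ z @ u @ A @ C"
    have len: "length x = n" "length y = n" "length z = n" "length u = n"
      "length A = n * n * n" "length C = n * n * n" using that by (auto simp: vectors_def)
    have v: "tvec K e n (vec_at 0) = x" "tvec K e n (vec_at n) = y" "tvec K e n (vec_at (n + n)) = z"
      "tvec K e n (vec_at (n + n + n)) = u"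
      using tvec_vec_at[of "[]" 0 x n K "y @ z @ u @ A @ C"] tvec_vec_at[of x n y n K "z @ u @ A @ C"]
        tvec_vec_at[of "x @ y" "n + n" z n K "u @ A @ C"] tvec_vec_at[of "x @ y @ z" "n + n + n" u n K "A @ C"]
      by (simp_all add: e_def len)
    have c: "tvec K e n (tmul n (mat_at n (n + n + n + n + n * n * n)) s t)
        = vmul K n (mat_of n C) (tvec K e n s) (tvec K e n t)" for s t
      using tvec_tmul_mat_at[of "x @ y @ z @ u @ A" "n + n + n + n + n * n * n" C n K "[]" s t]
      by (simp add: e_def len)
    have a: "tvec K e n (tapp n (mat_at n (n + n + n + n)) g s)
        = vapp K n (mat_of n A) g (tvec K e n s)" if "g < n" for g s
      using tvec_tapp_mat_at[of "x @ y @ z @ u" "n + n + n + n" A n g K C s] that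
      by (simp add: e_def len)
    show ?thesis
      unfolding e_def[symmetric]
      by (simp add: data_axioms_def Let_def satisfies_veq satisfies_conjs c v a lk)
  qed
  have inv: "satisfies K (y @ x @ u @ A @ C) (inverse_axiom n) \<longleftrightarrow>
      x = replicate n \<zero>\<^bsub>K\<^esub> \<or> vmul K n (mat_of n C) x y = u"
    if C: "C \<in> vectors K (n * n * n)" and A: "A \<in> vectors K (n * n * n)" and u: "u \<in> vectors K n"
      and x: "x \<in> vectors K n" and y: "y \<in> vectors K n" for x y u A C
  proof -
    have len: "length x = n" "length y = n" "length u = n"
      "length A = n * n * n" "length C = n * n * n" using that by (auto simp: vectors_def)
    show ?thesis
      using tvec_vec_at[of "[]" 0 y n K "x @ u @ A @ C"] tvec_vec_at[of y n x n K "u @ A @ C"]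
        tvec_vec_at[of "y @ x" "n + n" u n K "A @ C"]
        tvec_tmul_mat_at[of "y @ x @ u @ A" "n + n + n + n * n * n" C n K "[]" "vec_at n" "vec_at 0"]
      by (simp add: len inverse_axiom_def satisfies_disj satisfies_veq tvec_zero)
  qed
  have dist: "satisfies K (x @ u @ A @ C) (Neg (veq n
        (tapp n (mat_at n (n + n)) g (vec_at 0)) (tapp n (mat_at n (n + n)) h (vec_at 0)))) \<longleftrightarrow>
      vapp K n (mat_of n A) g x \<noteq> vapp K n (mat_of n A) h x"
    if C: "C \<in> vectors K (n * n * n)" and A: "A \<in> vectors K (n * n * n)" and u: "u \<in> vectors K n"
      and x: "x \<in> vectors K n" and gh: "g < n" "h < n" for x u A C g h
  proof -
    have len: "length x = n" "length u = n"
      "length A = n * n * n" "length C = n * n * n" using that by (auto simp: vectors_def)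
    show ?thesis
      using tvec_vec_at[of "[]" 0 x n K "u @ A @ C"] gh
        tvec_tapp_mat_at[of "x @ u" "n + n" A n _ K C "vec_at 0"]
      by (simp add: len satisfies_veq)
  qed
  have zero: "satisfies K (u @ A @ C) (veq n (vec_at 0) zero_terms) \<longleftrightarrow> u = replicate n \<zero>\<^bsub>K\<^esub>"
    if "u \<in> vectors K n" for u A C
    using tvec_vec_at[of "[]" 0 u n K "A @ C"] that by (simp add: satisfies_veq tvec_zero vectors_def)
  show ?thesis
    unfolding models_def igp_formula_def satisfies_exs append_Nil2
  proof (intro bex_cong refl)
    fix C A u
    assume C: "C \<in> vectors K (n * n * n)" and A: "A \<in> vectors K (n * n * n)" and u: "u \<in> vectors K n"
    show "satisfies K (u @ A @ C)
      (Conj (alls n (alls n (alls n (data_axioms n lk))))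
      (Conj (Neg (veq n (vec_at 0) zero_terms))
      (Conj (alls n (exs n (inverse_axiom n)))
            (conjs n (\<lambda>g. conjs g (\<lambda>h. exs n (Neg (veq n
              (tapp n (mat_at n (n + n)) g (vec_at 0)) (tapp n (mat_at n (n + n)) h (vec_at 0)))))))))) \<longleftrightarrow>
      galois_data K n lk (mat_of n C) (mat_of n A) u"
      unfolding galois_data_def satisfies.simps(3) satisfies_alls satisfies_conjs satisfies_exs
    proof (intro conj_cong ball_cong bex_cong all_cong refl)
      fix z y x assume "z \<in> vectors K n" "y \<in> vectors K n" "x \<in> vectors K n"
      then show "satisfies K (x @ y @ z @ u @ A @ C) (data_axioms n lk) \<longleftrightarrow>
        vmul K n (mat_of n C) (vmul K n (mat_of n C) x y) z = vmul K n (mat_of n C) x (vmul K n (mat_of n C) y z) \<and>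
        vmul K n (mat_of n C) x y = vmul K n (mat_of n C) y x \<and>
        vmul K n (mat_of n C) u x = x \<and>
        (\<forall>g<n. vapp K n (mat_of n A) g (vmul K n (mat_of n C) x y)
          = vmul K n (mat_of n C) (vapp K n (mat_of n A) g x) (vapp K n (mat_of n A) g y)) \<and>
        (\<forall>g<n. vapp K n (mat_of n A) g u = u) \<and>
        (\<forall>g<n. \<forall>h<n. vapp K n (mat_of n A) g (vapp K n (mat_of n A) h x) = vapp K n (mat_of n A) (lk g h) x)"
        using data C A u by blast
    next
      show "satisfies K (u @ A @ C) (Neg (veq n (vec_at 0) zero_terms)) \<longleftrightarrow> u \<noteq> replicate n \<zero>\<^bsub>K\<^esub>"
        using zero[OF u] by simp
    next
      fix x y assume "x \<in> vectors K n" "y \<in> vectors K n"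
      then show "satisfies K (y @ x @ u @ A @ C) (inverse_axiom n) \<longleftrightarrow>
        x = replicate n \<zero>\<^bsub>K\<^esub> \<or> vmul K n (mat_of n C) x y = u"
        by (rule inv[OF C A u])
    next
      fix g h x assume "g < n" "h < g" "x \<in> vectors K n"
      then show "satisfies K (x @ u @ A @ C) (Neg (veq n
          (tapp n (mat_at n (n + n)) g (vec_at 0)) (tapp n (mat_at n (n + n)) h (vec_at 0)))) \<longleftrightarrow>
        vapp K n (mat_of n A) g x \<noteq> vapp K n (mat_of n A) h x"
        by (intro dist[OF C A u]) auto
    qed
  qed
qed

lemma term_in_tsum: "term_in N (tsum m f) \<longleftrightarrow> (\<forall>i<m. term_in N (f i))"
  by (induction m) (auto simp: less_Suc_eq)

lemma formula_in_conjs: "formula_in N (conjs m f) \<longleftrightarrow> (\<forall>i<m. formula_in N (f i))"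
  by (induction m) (auto simp: less_Suc_eq)

lemma formula_in_exs: "formula_in N (exs m \<phi>) \<longleftrightarrow> formula_in (m + N) \<phi>"
  by (induction m arbitrary: N) auto

lemma sentence_igp_formula:
  assumes "\<And>g h. g < n \<Longrightarrow> h < n \<Longrightarrow> lk g h < n"
  shows "sentence (igp_formula n lk)"
proof -
  have "(i * n + j) * n + k < n * n * n" if "i < n" "j < n" "k < n" for i j k
    using that by (intro index_less) auto
  then show ?thesis
    using assms
    by (auto simp: sentence_def igp_formula_def data_axioms_def inverse_axiom_def Let_def alls_def
        disj_def veq_def tmul_def tapp_def vec_at_def mat_at_def zero_terms_def
        formula_in_exs formula_in_conjs term_in_tsum add.assoc intro: trans_less_add2)
qed


section \<open>Computability of the sentence\<close>

text \<open>Arguments are passed as \<open>e 0, \<dots>, e (k - 1)\<close>, so that a bound variable is one more argument in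
  front and the closure rules below can be applied by resolution.\<close>

definition computable :: "nat \<Rightarrow> ((nat \<Rightarrow> nat) \<Rightarrow> nat) \<Rightarrow> bool" where
  "computable k f \<longleftrightarrow> (\<exists>p. \<forall>B xs. length xs = k \<longrightarrow> computes B p xs (f (\<lambda>i. xs ! i)))"

lemma computableI: "(\<And>B xs. length xs = k \<Longrightarrow> computes B p xs (f (\<lambda>i. xs ! i))) \<Longrightarrow> computable k f"
  unfolding computable_def by blast

lemma computableE:
  assumes "computable k f"
  obtains p where "\<And>B xs. length xs = k \<Longrightarrow> computes B p xs (f (\<lambda>i. xs ! i))"
  using assms unfolding computable_def by blast

lemma computable_var: "i < k \<Longrightarrow> computable k (\<lambda>e. e i)"
  by (rule computableI[of _ "Proj i"]) (simp add: computes.proj)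

lemma computable_comp1:
  assumes g: "computable 1 (\<lambda>e. g (e 0))" and f: "computable k f"
  shows "computable k (\<lambda>e. g (f e))"
proof -
  obtain p where p: "\<And>B xs. length xs = 1 \<Longrightarrow> computes B p xs (g (xs ! 0))"
    using g by (rule computableE) blast
  obtain q where q: "\<And>B xs. length xs = k \<Longrightarrow> computes B q xs (f (\<lambda>i. xs ! i))"
    using f by (rule computableE) blast
  show ?thesis
  proof (rule computableI[of _ "Comp p [q]"])
    fix B and xs :: "nat list" assume xs: "length xs = k"
    show "computes B (Comp p [q]) xs (g (f (\<lambda>i. xs ! i)))"
      using q[OF xs, of B] p[of "[f (\<lambda>i. xs ! i)]" B] by (intro computes.comp[of _ _ _ "[f (\<lambda>i. xs ! i)]"]) auto
  qed
qed

lemma computable_comp2: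
  assumes g: "computable 2 (\<lambda>e. g (e 0) (e 1))" and f: "computable k f1" "computable k f2"
  shows "computable k (\<lambda>e. g (f1 e) (f2 e))"
proof -
  obtain p where p: "\<And>B xs. length xs = 2 \<Longrightarrow> computes B p xs (g (xs ! 0) (xs ! 1))"
    using g by (rule computableE) blast
  obtain q1 where q1: "\<And>B xs. length xs = k \<Longrightarrow> computes B q1 xs (f1 (\<lambda>i. xs ! i))"
    using f(1) by (rule computableE) blast
  obtain q2 where q2: "\<And>B xs. length xs = k \<Longrightarrow> computes B q2 xs (f2 (\<lambda>i. xs ! i))"
    using f(2) by (rule computableE) blast
  show ?thesis
  proof (rule computableI[of _ "Comp p [q1, q2]"])
    fix B and xs :: "nat list" assume xs: "length xs = k"
    let ?e = "\<lambda>i. xs ! i"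
    show "computes B (Comp p [q1, q2]) xs (g (f1 ?e) (f2 ?e))"
      using q1[OF xs, of B] q2[OF xs, of B] p[of "[f1 ?e, f2 ?e]" B]
      by (intro computes.comp[of _ _ _ "[f1 ?e, f2 ?e]"]) auto
  qed
qed

lemma computable_Suc: "computable k f \<Longrightarrow> computable k (\<lambda>e. Suc (f e))"
proof (rule computable_comp1[where g = Suc])
  show "computable 1 (\<lambda>e. Suc (e 0))"
    by (rule computableI[of _ Succ]) (auto simp: length_Suc_conv intro: computes.succ)
qed

lemma computable_const: "computable k (\<lambda>e. c)"
proof (induction c)
  case 0
  then show ?case by (rule computableI[of _ Zero]) (rule computes.zero)
next
  case (Suc c)
  then show ?case by (rule computable_Suc)
qed

text \<open>These projections skip \<open>ys\<close> and hand on \<open>xs\<close>; inside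
  \<open>Comp\<close> they pass parameters to a recursion or discard arguments.\<close>

lemma list_all2_projs: "list_all2 (\<lambda>q y. computes B q (ys @ xs) y) (map (\<lambda>i. Proj (length ys + i)) [0..<length xs]) xs"
proof (rule list_all2_all_nthI)
  fix i assume "i < length (map (\<lambda>i. Proj (length ys + i)) [0..<length xs])"
  then show "computes B (map (\<lambda>i. Proj (length ys + i)) [0..<length xs] ! i) (ys @ xs) (xs ! i)"
    using computes.proj[of "length ys + i" "ys @ xs" B] by simp
qed simp

text \<open>\<open>PrimRec\<close> recurses on its first argument, so the composite program puts
  \<open>m\<close> in front of a copy of all parameters. In the step, \<open>e 0\<close> is the
  counter, \<open>e 1\<close> the previous value, and the parameters are shifted by two.\<close>

lemma computable_rec:
  assumes z: "computable k z" and s: "computable (Suc (Suc k)) (\<lambda>e. s (e 0) (e 1) (\<lambda>i. e (Suc (Suc i))))" and m: "computable k m"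
  shows "computable k (\<lambda>e. rec_nat (z e) (\<lambda>i r. s i r e) (m e))"
proof -
  obtain pz where pz: "\<And>B xs. length xs = k \<Longrightarrow> computes B pz xs (z (\<lambda>i. xs ! i))"
    using z by (rule computableE) blast
  obtain pm where pm: "\<And>B xs. length xs = k \<Longrightarrow> computes B pm xs (m (\<lambda>i. xs ! i))"
    using m by (rule computableE) blast
  obtain ps where ps: "\<And>B i r xs. length xs = k \<Longrightarrow> computes B ps (i # r # xs) (s i r (\<lambda>i. xs ! i))"
  proof -
    obtain ps where "\<And>B xs. length xs = Suc (Suc k) \<Longrightarrow>
        computes B ps xs (s (xs ! 0) (xs ! 1) (\<lambda>i. xs ! Suc (Suc i)))"
      using s by (rule computableE) blast
    from this[of "_ # _ # _"] show ?thesis by (intro that[of ps]) simp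
  qed
  have rec: "computes B (PrimRec pz ps) (j # xs) (rec_nat (z (\<lambda>i. xs ! i)) (\<lambda>i r. s i r (\<lambda>i. xs ! i)) j)"
    if xs: "length xs = k" for B j xs
    by (induction j) (auto intro!: computes.rec_0 computes.rec_Suc pz ps xs)
  show ?thesis
  proof (rule computableI[of _ "Comp (PrimRec pz ps) (pm # map (\<lambda>i. Proj (0 + i)) [0..<k])"])
    fix B and xs :: "nat list" assume xs: "length xs = k"
    show "computes B (Comp (PrimRec pz ps) (pm # map (\<lambda>i. Proj (0 + i)) [0..<k])) xs
        (rec_nat (z (\<lambda>i. xs ! i)) (\<lambda>i r. s i r (\<lambda>i. xs ! i)) (m (\<lambda>i. xs ! i)))"
      using pm[OF xs, of B] rec[OF xs, of B] list_all2_projs[of B "[]" xs] xs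
      by (intro computes.comp[of _ _ _ "m (\<lambda>i. xs ! i) # xs"]) auto
  qed
qed

text \<open>By \<open>ex\<close> the search halts on every input, and by totality of
  \<open>g\<close> every rejected candidate has a defined positive value, as \<open>Minim\<close>
  demands.\<close>

lemma computable_Least:
  assumes g: "computable (Suc k) (\<lambda>e. g (e 0) (\<lambda>i. e (Suc i)))" and ex: "\<And>e. \<exists>j. g j e = 0"
  shows "computable k (\<lambda>e. LEAST j. g j e = 0)"
proof -
  obtain p where p: "\<And>B xs. length xs = Suc k \<Longrightarrow> computes B p xs (g (xs ! 0) (\<lambda>i. xs ! Suc i))"
    using g by (rule computableE) blast
  show ?thesis
  proof (rule computableI[of _ "Minim p"])
    fix B and xs :: "nat list" assume xs: "length xs = k"
    have *: "computes B p (j # xs) (g j (\<lambda>i. xs ! i))" for j using p[of "j # xs" B] xs by simp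
    show "computes B (Minim p) xs (LEAST j. g j (\<lambda>i. xs ! i) = 0)"
    proof (rule computes.minim)
      show "computes B p ((LEAST j. g j (\<lambda>i. xs ! i) = 0) # xs) 0"
        using LeastI_ex[OF ex, of "\<lambda>i. xs ! i"] * by metis
      fix m assume "m < (LEAST j. g j (\<lambda>i. xs ! i) = 0)"
      then have "g m (\<lambda>i. xs ! i) > 0" using not_less_Least by blast
      then show "\<exists>v>0. computes B p (m # xs) v" using * by blast
    qed
  qed
qed

section \<open>Arithmetic and the pairing function\<close>

lemma computable_add: "computable k f \<Longrightarrow> computable k g \<Longrightarrow> computable k (\<lambda>e. f e + g e)"
proof -
  have "m + n = rec_nat n (\<lambda>_ r. Suc r) m" for m n :: nat by (induction m) auto
  then show "computable k f \<Longrightarrow> computable k g \<Longrightarrow> computable k (\<lambda>e. f e + g e)"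
    by (simp only:) (intro computable_rec computable_Suc computable_var, auto)
qed

lemma computable_mult: "computable k f \<Longrightarrow> computable k g \<Longrightarrow> computable k (\<lambda>e. f e * g e)"
proof (rule computable_comp2[where g = "(*)"])
  have "m * n = rec_nat 0 (\<lambda>_ r. n + r) m" for m n :: nat by (induction m) auto
  then show "computable 2 (\<lambda>e. e 0 * e 1)"
    by (simp only:) (intro computable_rec computable_add computable_var computable_const; simp)
qed

lemma computable_diff: "computable k f \<Longrightarrow> computable k g \<Longrightarrow> computable k (\<lambda>e. f e - g e)"
proof (rule computable_comp2[where g = "(-)"])
  \<comment> \<open>Predecessor is the recursion that returns its counter and forgets the previous
    value; truncated subtraction iterates it.\<close>
  have pred: "n - 1 = rec_nat 0 (\<lambda>i _. i) n" for n :: nat by (cases n) auto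
  have "computable 1 (\<lambda>e. e 0 - 1)"
    unfolding pred by (intro computable_rec computable_var computable_const) auto
  then have *: "computable k f \<Longrightarrow> computable k (\<lambda>e. f e - 1)" for k f by (rule computable_comp1)
  have "rec_nat m (\<lambda>_ r. r - 1) n = m - n" for m n :: nat by (induction n) auto
  moreover have "computable 2 (\<lambda>e. rec_nat (e 0) (\<lambda>_ r. r - 1) (e 1))"
    by (intro computable_rec * computable_var; simp)
  ultimately show "computable 2 (\<lambda>e. e 0 - e 1)" by (simp only:)
qed

lemma computable_triangle: "computable k f \<Longrightarrow> computable k (\<lambda>e. triangle (f e))"
proof (rule computable_comp1[where g = triangle])
  have "triangle n = rec_nat 0 (\<lambda>i r. r + Suc i) n" for n by (induction n) auto
  then show "computable 1 (\<lambda>e. triangle (e 0))"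
    by (simp only:) (intro computable_rec computable_add computable_Suc computable_var computable_const; simp)
qed

lemma computable_prod_encode: "computable k f \<Longrightarrow> computable k g \<Longrightarrow> computable k (\<lambda>e. prod_encode (f e, g e))"
  unfolding prod_encode_def by (auto intro!: computable_add computable_triangle)

lemma triangle_mono: "m \<le> n \<Longrightarrow> triangle m \<le> triangle n"
  by (induction rule: dec_induct) auto

text \<open>The code of \<open>(m, n)\<close> is \<open>triangle (m + n) + m\<close>, so
  \<open>m + n\<close> is the number of the diagonal on which \<open>z\<close> lies. It is the least
  \<open>t\<close> with \<open>z < triangle (Suc t)\<close>, an inequality that truncated
  subtraction turns into an equation suitable for minimization.\<close>

lemma fst_add_snd_prod_decode:
  "fst (prod_decode z) + snd (prod_decode z) = (LEAST t. Suc z - triangle (Suc t) = 0)"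
proof -
  obtain m n where mn: "prod_decode z = (m, n)" by (cases "prod_decode z")
  then have "prod_encode (m, n) = z" by (metis prod_decode_inverse)
  then have z: "z = triangle (m + n) + m" by (simp add: prod_encode_def)
  have "(LEAST t. Suc z - triangle (Suc t) = 0) = m + n"
  proof (rule Least_equality)
    fix t assume "Suc z - triangle (Suc t) = 0"
    then have *: "triangle (m + n) < triangle (Suc t)" using z by simp
    show "m + n \<le> t" using triangle_mono[of "Suc t" "m + n"] * by (meson not_less_eq_eq leD)
  qed (simp add: z)
  then show ?thesis by (simp add: mn)
qed

lemma computable_fst_prod_decode: "computable k f \<Longrightarrow> computable k (\<lambda>e. fst (prod_decode (f e)))"
  and computable_snd_prod_decode: "computable k f \<Longrightarrow> computable k (\<lambda>e. snd (prod_decode (f e)))"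
proof -
  let ?t = "\<lambda>z. LEAST t. Suc z - triangle (Suc t) = 0"
  have ex: "\<exists>t. Suc z - triangle (Suc t) = 0" for z
  proof -
    have "z \<le> triangle z" by (induction z) auto
    then show ?thesis by (intro exI[of _ z]) simp
  qed
  have t: "computable 1 (\<lambda>e. ?t (e 0))"
    by (intro computable_Least ex computable_diff computable_Suc computable_triangle computable_var) auto
  have fst: "fst (prod_decode z) = z - triangle (?t z)" for z
    unfolding fst_add_snd_prod_decode[symmetric]
    using prod_decode_inverse[of z] by (cases "prod_decode z") (simp add: prod_encode_def)
  have snd: "snd (prod_decode z) = ?t z - fst (prod_decode z)" for z
    unfolding fst_add_snd_prod_decode[symmetric] by simp
  have 1: "computable 1 (\<lambda>e. fst (prod_decode (e 0)))"
    unfolding fst by (intro computable_diff computable_triangle t computable_var) auto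
  then have 2: "computable 1 (\<lambda>e. snd (prod_decode (e 0)))"
    unfolding snd by (intro computable_diff t)
  show "computable k f \<Longrightarrow> computable k (\<lambda>e. fst (prod_decode (f e)))"
    by (rule computable_comp1[where g = "\<lambda>z. fst (prod_decode z)", OF 1])
  show "computable k f \<Longrightarrow> computable k (\<lambda>e. snd (prod_decode (f e)))"
    by (rule computable_comp1[where g = "\<lambda>z. snd (prod_decode z)", OF 2])
qed

section \<open>Reading lists from their codes\<close>

definition drop_code :: "nat \<Rightarrow> nat \<Rightarrow> nat" where
  "drop_code t i = rec_nat t (\<lambda>_ r. snd (prod_decode (r - 1))) i"

definition nth_code :: "nat \<Rightarrow> nat \<Rightarrow> nat" where
  "nth_code t i = fst (prod_decode (drop_code t i - 1))"

definition length_code :: "nat \<Rightarrow> nat" where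
  "length_code t = (LEAST i. drop_code t i = 0)"

text \<open>A nonempty list is coded by the successor of a pair of its head and the code of its
  tail, so each step takes a predecessor, unpairs it and keeps the second component.\<close>

lemma drop_code: "drop_code (list_encode xs) i = list_encode (drop i xs)"
proof (induction i)
  case (Suc i)
  \<comment> \<open>The empty list has code 0 and must be its own tail: \<open>0 - 1 = 0\<close>
    decodes to \<open>(0, 0)\<close>, so dropping beyond the end stays at 0.\<close>
  have 0: "prod_decode 0 = (0, 0)" using prod_encode_inverse[of "(0, 0)"] by (simp add: prod_encode_def)
  have "drop_code (list_encode xs) (Suc i) = snd (prod_decode (list_encode (drop i xs) - 1))"
    using Suc by (simp add: drop_code_def)
  also have "\<dots> = list_encode (tl (drop i xs))"
    by (cases "drop i xs") (simp_all add: 0)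
  finally show ?case by (simp add: drop_Suc tl_drop)
qed (simp add: drop_code_def)

lemma nth_code: "i < length xs \<Longrightarrow> nth_code (list_encode xs) i = xs ! i"
  by (simp add: nth_code_def drop_code Cons_nth_drop_Suc[symmetric])

lemma list_encode_eq_0: "list_encode xs = 0 \<longleftrightarrow> xs = []"
  by (cases xs) auto

lemma length_code: "length_code (list_encode xs) = length xs"
  unfolding length_code_def drop_code list_encode_eq_0 by (intro Least_equality) auto

lemma computable_drop_code: "computable k f \<Longrightarrow> computable k g \<Longrightarrow> computable k (\<lambda>e. drop_code (f e) (g e))"
  unfolding drop_code_def by (intro computable_rec computable_snd_prod_decode computable_diff computable_var computable_const) auto

lemma computable_nth_code: "computable k f \<Longrightarrow> computable k g \<Longrightarrow> computable k (\<lambda>e. nth_code (f e) (g e))"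
  unfolding nth_code_def by (intro computable_drop_code computable_fst_prod_decode computable_diff computable_const) auto

lemma computable_length_code: "computable k f \<Longrightarrow> computable k (\<lambda>e. length_code (f e))"
proof (rule computable_comp1[where g = length_code])
  have "\<exists>i. drop_code t i = 0" for t
  proof -
    have "drop_code (list_encode (list_decode t)) (length (list_decode t)) = 0"
      unfolding drop_code by simp
    then show ?thesis by auto
  qed
  then show "computable 1 (\<lambda>e. length_code (e 0))"
    unfolding length_code_def by (intro computable_Least computable_drop_code computable_var) auto
qed

section \<open>Codes of terms and formulas with computed parameters\<close>

lemma computable_TVar: "computable k f \<Longrightarrow> computable k (\<lambda>e. term_code (N e) (TVar (f e)))"
  by simp

lemma computable_TZero: "computable k N \<Longrightarrow> computable k (\<lambda>e. term_code (N e) TZero)"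
  by simp

lemma computable_TMul:
  assumes "computable k N" "computable k (\<lambda>e. term_code (N e) (s e))" "computable k (\<lambda>e. term_code (N e) (t e))"
  shows "computable k (\<lambda>e. term_code (N e) (TMul (s e) (t e)))"
  unfolding term_code.simps by (intro computable_add computable_mult computable_prod_encode computable_const assms)

lemma computable_weaken2:
  assumes "computable k f"
  shows "computable (Suc (Suc k)) (\<lambda>e. f (\<lambda>i. e (Suc (Suc i))))"
proof -
  obtain p where p: "\<And>B xs. length xs = k \<Longrightarrow> computes B p xs (f (\<lambda>i. xs ! i))"
    using assms by (rule computableE) blast
  show ?thesis
  proof (rule computableI[of _ "Comp p (map (\<lambda>i. Proj (2 + i)) [0..<k])"])
    fix B and xs :: "nat list" assume "length xs = Suc (Suc k)"
    then obtain x y ys where xs: "xs = x # y # ys" "length ys = k" by (auto simp: length_Suc_conv)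
    show "computes B (Comp p (map (\<lambda>i. Proj (2 + i)) [0..<k])) xs (f (\<lambda>i. xs ! (Suc (Suc i))))"
      using list_all2_projs[of B "[x, y]" ys] xs p[of ys B]
      by (intro computes.comp[of _ _ _ ys]) auto
  qed
qed

text \<open>In the recursions below the previous value occupies position 1; a function of the
  counter and the parameters has to skip it.\<close>

lemma computable_weaken_second:
  assumes "computable (Suc k) (\<lambda>e. f (e 0) (\<lambda>i. e (Suc i)))"
  shows "computable (Suc (Suc k)) (\<lambda>e. f (e 0) (\<lambda>i. e (Suc (Suc i))))"
proof -
  obtain p where p: "\<And>B xs. length xs = Suc k \<Longrightarrow> computes B p xs (f (xs ! 0) (\<lambda>i. xs ! Suc i))"
    using assms by (rule computableE) blast
  show ?thesis
  proof (rule computableI[of _ "Comp p (Proj 0 # map (\<lambda>i. Proj (2 + i)) [0..<k])"])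
    fix B and xs :: "nat list" assume "length xs = Suc (Suc k)"
    then obtain x y ys where xs: "xs = x # y # ys" "length ys = k" by (auto simp: length_Suc_conv)
    show "computes B (Comp p (Proj 0 # map (\<lambda>i. Proj (2 + i)) [0..<k])) xs (f (xs ! 0) (\<lambda>i. xs ! (Suc (Suc i))))"
      using list_all2_projs[of B "[x, y]" ys] xs p[of "x # ys" B] computes.proj[of 0 xs B]
      by (intro computes.comp[of _ _ _ "x # ys"]) auto
  qed
qed

text \<open>The code is a recursion on the length that starts from \<open>N\<close>, the code of
  \<open>TZero\<close> in a scope of \<open>N\<close> variables. The scope size enters the code of
  every term other than a variable, hence it is carried along as a computable function.\<close>

lemma computable_tsum:
  assumes N: "computable k N" and m: "computable k m"
    and f: "computable (Suc k) (\<lambda>e. term_code (N (\<lambda>i. e (Suc i))) (f (\<lambda>i. e (Suc i)) (e 0)))"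
  shows "computable k (\<lambda>e. term_code (N e) (tsum (m e) (f e)))"
proof -
  have *: "term_code N (tsum m f) = rec_nat N (\<lambda>i r. N + 2 + 2 * prod_encode (term_code N (f i), r)) m" for N m f
    by (induction m) auto
  show ?thesis
    unfolding *
    by (intro computable_rec[where s = "\<lambda>i r e. N e + 2 + 2 * prod_encode (term_code (N e) (f e i), r)"]
        computable_add computable_mult computable_prod_encode computable_const computable_var m N computable_weaken2[OF N]
        computable_weaken_second[where f = "\<lambda>i e. term_code (N e) (f e i)", OF f]) auto
qed

lemma computable_Equal:
  assumes "computable k (\<lambda>e. term_code (N e) (s e))" "computable k (\<lambda>e. term_code (N e) (t e))"
  shows "computable k (\<lambda>e. formula_code (N e) (Equal (s e) (t e)))"
  unfolding formula_code.simps by (intro computable_mult computable_prod_encode computable_const assms)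

lemma computable_Neg:
  assumes "computable k (\<lambda>e. formula_code (N e) (\<phi> e))"
  shows "computable k (\<lambda>e. formula_code (N e) (Neg (\<phi> e)))"
  unfolding formula_code.simps by (intro computable_add computable_mult computable_const assms)

lemma computable_Conj:
  assumes "computable k (\<lambda>e. formula_code (N e) (\<phi> e))" "computable k (\<lambda>e. formula_code (N e) (\<psi> e))"
  shows "computable k (\<lambda>e. formula_code (N e) (Conj (\<phi> e) (\<psi> e)))"
  unfolding formula_code.simps by (intro computable_add computable_mult computable_prod_encode computable_const assms)

lemma computable_conjs:
  assumes N: "computable k N" and m: "computable k m"
    and f: "computable (Suc k) (\<lambda>e. formula_code (N (\<lambda>i. e (Suc i))) (f (\<lambda>i. e (Suc i)) (e 0)))"
  shows "computable k (\<lambda>e. formula_code (N e) (conjs (m e) (f e)))"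
proof -
  have *: "formula_code N (conjs m f) =
      rec_nat (4 * prod_encode (N, N)) (\<lambda>i r. 4 * prod_encode (r, formula_code N (f i)) + 2) m" for N m f
    by (induction m) auto
  show ?thesis
    unfolding *
    by (intro computable_rec[where s = "\<lambda>i r e. 4 * prod_encode (r, formula_code (N e) (f e i)) + 2"]
        computable_add computable_mult computable_prod_encode computable_const computable_var m N
        computable_weaken_second[where f = "\<lambda>i e. formula_code (N e) (f e i)", OF f]) auto
qed

text \<open>The body is coded once, in the scope enlarged by the whole block. Although the scope
  shrinks with each quantifier put in front, its effect on codes is always \<open>r\<close> |->
  \<open>4 * r + 3\<close>, so that this map only has to be iterated.\<close>

lemma computable_exs:
  assumes m: "computable k m" and \<phi>: "computable k (\<lambda>e. formula_code (m e + N e) (\<phi> e))"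
  shows "computable k (\<lambda>e. formula_code (N e) (exs (m e) (\<phi> e)))"
proof -
  have *: "formula_code N (exs m \<phi>) = rec_nat (formula_code (m + N) \<phi>) (\<lambda>_ r. 4 * r + 3) m" for N m \<phi>
    by (induction m arbitrary: N) auto
  show ?thesis
    unfolding *
    by (intro computable_rec[where s = "\<lambda>i r e. 4 * r + 3"] computable_add computable_mult computable_const computable_var m \<phi>) auto
qed

lemmas computable_intros = computable_conjs computable_exs computable_Conj computable_Neg computable_Equal computable_tsum computable_TMul computable_TZero
  computable_TVar computable_nth_code computable_add computable_mult computable_Suc computable_var computable_const

text \<open>With all abbreviations unfolded, the closure rules follow the shape of the formula. The
  group law appears as a lookup in a coded table, which is itself a computable function of
  numbers.\<close>

lemma computable_igp_formula:
  "computable 2 (\<lambda>e. formula_code 0 (igp_formula (e 0) (\<lambda>g h. nth_code (nth_code (e 1) g) h)))"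
  unfolding igp_formula_def data_axioms_def inverse_axiom_def Let_def alls_def disj_def veq_def
    tmul_def tapp_def vec_at_def mat_at_def zero_terms_def
  by (intro computable_intros) simp_all


section \<open>Countable elementary substructures\<close>

instance ring_term :: countable by countable_datatype
instance ring_formula :: countable by countable_datatype

text \<open>A Skolem function for \<open>\<phi>\<close>; the default \<open>\<zero>\<close> keeps
  its values inside the carrier of a ring.\<close>

definition witness :: "('a, 'b) ring_scheme \<Rightarrow> ring_formula \<Rightarrow> 'a list \<Rightarrow> 'a" where
  "witness K \<phi> e = (if \<exists>x\<in>carrier K. satisfies K (x # e) \<phi>
    then SOME x. x \<in> carrier K \<and> satisfies K (x # e) \<phi> else \<zero>\<^bsub>K\<^esub>)"

lemma witness: "x \<in> carrier K \<Longrightarrow> satisfies K (x # e) \<phi> \<Longrightarrow> satisfies K (witness K \<phi> e # e) \<phi>"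
  unfolding witness_def using someI[of "\<lambda>x. x \<in> carrier K \<and> satisfies K (x # e) \<phi>" x] by auto

primrec skolem_stage :: "('a, 'b) ring_scheme \<Rightarrow> nat \<Rightarrow> 'a set" where
  "skolem_stage K 0 = {}"
| "skolem_stage K (Suc m) = skolem_stage K m \<union> (\<lambda>(\<phi>, e). witness K \<phi> e) ` (UNIV \<times> lists (skolem_stage K m))"

definition skolem_hull :: "('a, 'b) ring_scheme \<Rightarrow> 'a set" where
  "skolem_hull K = (\<Union>m. skolem_stage K m)"

text \<open>There are countably many formulas, and countably many parameter lists over a countable
  stage.\<close>

lemma countable_skolem_hull: "countable (skolem_hull K)"
proof -
  have "countable (skolem_stage K m)" for m
    by (induction m) (auto intro!: countable_image countable_SIGMA)
  then show ?thesis by (auto simp: skolem_hull_def)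
qed

text \<open>The stages increase, so the finitely many entries of \<open>e\<close> lie in a common
  stage; the witness appears in the next one.\<close>

lemma witness_in_skolem_hull:
  assumes "set e \<subseteq> skolem_hull K"
  shows "witness K \<phi> e \<in> skolem_hull K"
proof -
  have mono: "skolem_stage K m \<subseteq> skolem_stage K m'" if "m \<le> m'" for m m'
    using that by (induction rule: dec_induct) auto
  from assms have "\<exists>m. set e \<subseteq> skolem_stage K m"
  proof (induction e)
    case (Cons x e)
    then obtain m m' where "set e \<subseteq> skolem_stage K m" "x \<in> skolem_stage K m'"
      by (auto simp: skolem_hull_def)
    then have "set (x # e) \<subseteq> skolem_stage K (max m m')"
      using mono[of m "max m m'"] mono[of m' "max m m'"] by auto
    then show ?case by blast
  qed auto
  then obtain m where "set e \<subseteq> skolem_stage K m" by blast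
  then have "witness K \<phi> e \<in> skolem_stage K (Suc m)"
    by (auto intro!: image_eqI[of _ _ "(\<phi>, e)"])
  then show ?thesis unfolding skolem_hull_def by blast
qed

lemma (in ring) skolem_hull_subset: "skolem_hull R \<subseteq> carrier R"
proof -
  have w: "witness R \<phi> e \<in> carrier R" for \<phi> e
    unfolding witness_def
    using someI_ex[of "\<lambda>x. x \<in> carrier R \<and> satisfies R (x # e) \<phi>"] by auto
  have "skolem_stage R m \<subseteq> carrier R" for m by (induction m) (auto simp: w)
  then show ?thesis by (auto simp: skolem_hull_def)
qed

text \<open>The Tarski-Vaught criterion: an existential statement true in \<open>R\<close> has its
  chosen witness in the hull.\<close>

lemma (in ring) satisfies_skolem_hull:
  "set e \<subseteq> skolem_hull R \<Longrightarrow> satisfies (R\<lparr>carrier := skolem_hull R\<rparr>) e \<phi> \<longleftrightarrow> satisfies R e \<phi>"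
proof (induction \<phi> arbitrary: e)
  case (Equal s t)
  have "term_val (R\<lparr>carrier := skolem_hull R\<rparr>) e t = term_val R e t" for t by (induction t) auto
  then show ?case by simp
next
  case (Ex \<phi>)
  then show ?case
    using witness[of _ R e \<phi>] witness_in_skolem_hull[of e R \<phi>] skolem_hull_subset by auto
qed auto

text \<open>When only \<open>y\<close> satisfies \<open>\<phi>\<close>, the chosen witness can be
  nothing but \<open>y\<close>. This closes the hull under every definable operation, including
  inverses.\<close>

lemma (in ring) definable_in_skolem_hull:
  assumes "set e \<subseteq> skolem_hull R" "y \<in> carrier R" "\<And>x. x \<in> carrier R \<Longrightarrow> satisfies R (x # e) \<phi> \<longleftrightarrow> x = y"
  shows "y \<in> skolem_hull R"
  using witness[of y R e \<phi>] assms witness_in_skolem_hull[of e R \<phi>] skolem_hull_subset by auto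

lemma (in field) skolem_hull_subfield: "subfield (skolem_hull R) R"
proof (rule subfieldI', rule subringI)
  note sub = skolem_hull_subset
  show "skolem_hull R \<subseteq> carrier R" by (rule sub)
  show "\<one> \<in> skolem_hull R"
    by (rule definable_in_skolem_hull[of "[]" _ "Equal (TVar 0) TOne"]) auto
  fix h assume h: "h \<in> skolem_hull R"
  show "\<ominus> h \<in> skolem_hull R"
    using h sub
    \<comment> \<open>Variable 0 stands for the value being defined, the variables from 1 on for the
      parameters.\<close>
    by (intro definable_in_skolem_hull[of "[h]" _ "Equal (TAdd (TVar 0) (TVar 1)) TZero"])
      (auto simp: subset_iff l_neg intro: minus_equality[symmetric])
  {
    fix k assume k: "k \<in> skolem_hull R"
    show "h \<otimes> k \<in> skolem_hull R"
      using h k sub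
      by (intro definable_in_skolem_hull[of "[h, k]" _ "Equal (TVar 0) (TMul (TVar 1) (TVar 2))"]) auto
    show "h \<oplus> k \<in> skolem_hull R"
      using h k sub
      by (intro definable_in_skolem_hull[of "[h, k]" _ "Equal (TVar 0) (TAdd (TVar 1) (TVar 2))"]) auto
  }
next
  fix k assume k: "k \<in> skolem_hull R - {\<zero>}"
  then have c: "k \<in> carrier R" "k \<in> Units R" using skolem_hull_subset by (auto simp: field_Units)
  show "inv k \<in> skolem_hull R"
    using k c comm_inv_char[of _ k]
    by (intro definable_in_skolem_hull[of "[k]" _ "Equal (TMul (TVar 1) (TVar 0)) TOne"])
      (auto simp: comm_inv_char)
qed

text \<open>The bound on the free variables matters: beyond the length of \<open>e\<close>, the
  entries of \<open>map f e\<close> and of \<open>e\<close> are unspecified and unrelated.\<close>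

lemma satisfies_iso:
  fixes K :: "('a, 'b) ring_scheme" and K' :: "('c, 'd) ring_scheme"
  assumes K: "ring K" "ring K'" and f: "f \<in> ring_iso K K'"
  shows "set e \<subseteq> carrier K \<Longrightarrow> formula_in (length e) \<phi> \<Longrightarrow> satisfies K' (map f e) \<phi> \<longleftrightarrow> satisfies K e \<phi>"
proof (induction \<phi> arbitrary: e)
  interpret K: ring K by fact
  have hom: "f \<in> ring_hom K K'" and bij: "bij_betw f (carrier K) (carrier K')"
    using f by (auto simp: ring_iso_def)
  {
    case (Equal s t)
    have *: "term_in (length e) t \<Longrightarrow>
        term_val K e t \<in> carrier K \<and> term_val K' (map f e) t = f (term_val K e t)" for t
      using Equal.prems(1) K hom
      by (induction t) (auto simp: ring_hom_add[OF hom] ring_hom_mult[OF hom] ring_hom_one[OF hom] ring_hom_zero)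
    from *[of s] *[of t] show ?case using Equal.prems bij by (auto simp: bij_betw_def inj_on_eq_iff)
  next
    case (Ex \<phi>)
    have "satisfies K' (map f e) (Ex \<phi>) \<longleftrightarrow> (\<exists>x\<in>carrier K. satisfies K' (map f (x # e)) \<phi>)"
      using bij_betw_imp_surj_on[OF bij, symmetric] by simp
    also have "\<dots> \<longleftrightarrow> satisfies K e (Ex \<phi>)"
      unfolding satisfies.simps using Ex by (intro bex_cong refl Ex.IH) auto
    finally show ?case .
  }
qed auto

text \<open>The hull is renamed by an injection into \<open>nat\<close> that need not be onto, so
  finite and infinite fields are treated alike.\<close>

theorem loewenheim_skolem:
  fixes K :: "('a, 'b) ring_scheme"
  assumes "field K"
  shows "\<exists>K' :: nat ring. field K' \<and> (\<forall>\<phi>. sentence \<phi> \<longrightarrow> (K' \<Turnstile> \<phi> \<longleftrightarrow> K \<Turnstile> \<phi>))"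
proof -
  interpret field K by fact
  let ?H = "K\<lparr>carrier := skolem_hull K\<rparr>"
  let ?f = "to_nat_on (skolem_hull K)"
  have H: "field ?H" using subfield_iff(2) skolem_hull_subfield by blast
  have inj: "inj_on ?f (carrier ?H)" using inj_on_to_nat_on[OF countable_skolem_hull] by simp
  interpret H: field ?H by (rule H)
  have "field (image_ring ?f ?H)" by (rule H.inj_imp_image_ring_is_field[OF inj])
  moreover have "image_ring ?f ?H \<Turnstile> \<phi> \<longleftrightarrow> K \<Turnstile> \<phi>" if "sentence \<phi>" for \<phi>
    using satisfies_iso[OF H.ring_axioms _ inj_imp_image_ring_iso[OF inj], of "[]" \<phi>]
      satisfies_skolem_hull[of "[]" \<phi>] that field.axioms(1)[OF calculation]
    by (auto simp: models_def sentence_def domain_def cring_def)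
  ultimately show ?thesis by blast
qed


section \<open>From a model of the sentence to a Galois extension\<close>

context ring
begin

lemma vsum_closed: "(\<And>i. i < m \<Longrightarrow> f i \<in> carrier R) \<Longrightarrow> vsum R m f \<in> carrier R"
  by (induction m) auto

lemma vsum_zero: "vsum R m (\<lambda>i. \<zero>) = \<zero>"
  by (induction m) auto

lemma vsum_add:
  "(\<And>i. i < m \<Longrightarrow> f i \<in> carrier R) \<Longrightarrow> (\<And>i. i < m \<Longrightarrow> g i \<in> carrier R) \<Longrightarrow>
    vsum R m (\<lambda>i. f i \<oplus> g i) = vsum R m f \<oplus> vsum R m g"
  by (induction m) (simp_all add: vsum_closed a_ac)

lemma vsum_rdistr:
  "(\<And>i. i < m \<Longrightarrow> f i \<in> carrier R) \<Longrightarrow> k \<in> carrier R \<Longrightarrow> k \<otimes> vsum R m f = vsum R m (\<lambda>i. k \<otimes> f i)"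
  by (induction m) (simp_all add: vsum_closed r_distr)

lemma vsum_ldistr:
  "(\<And>i. i < m \<Longrightarrow> f i \<in> carrier R) \<Longrightarrow> k \<in> carrier R \<Longrightarrow> vsum R m f \<otimes> k = vsum R m (\<lambda>i. f i \<otimes> k)"
  by (induction m) (simp_all add: vsum_closed l_distr)

lemma vsum_swap:
  "(\<And>i j. i < m \<Longrightarrow> j < l \<Longrightarrow> f i j \<in> carrier R) \<Longrightarrow>
    vsum R m (\<lambda>i. vsum R l (f i)) = vsum R l (\<lambda>j. vsum R m (\<lambda>i. f i j))"
  by (induction m) (simp_all add: vsum_zero vsum_add vsum_closed)

end

lemma (in ring_hom_ring) hom_vsum:
  "(\<And>i. i < m \<Longrightarrow> f i \<in> carrier R) \<Longrightarrow> h (vsum R m f) = vsum S m (\<lambda>i. h (f i))"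
  by (induction m) (simp_all add: R.vsum_closed)

section \<open>Coordinate vectors: linearity of products and operators\<close>

definition vadd :: "('a, 'b) ring_scheme \<Rightarrow> 'a list \<Rightarrow> 'a list \<Rightarrow> 'a list" where
  "vadd K x y = map2 (\<lambda>a b. a \<oplus>\<^bsub>K\<^esub> b) x y"

definition vscale :: "('a, 'b) ring_scheme \<Rightarrow> 'a \<Rightarrow> 'a list \<Rightarrow> 'a list" where
  "vscale K k x = map (\<lambda>a. k \<otimes>\<^bsub>K\<^esub> a) x"

lemma length_vectors: "x \<in> vectors K n \<Longrightarrow> length x = n"
  by (simp add: vectors_def)

lemma nth_vectors: "x \<in> vectors K n \<Longrightarrow> i < n \<Longrightarrow> x ! i \<in> carrier K"
  by (auto simp: vectors_def)

lemma vectorsI: "length x = n \<Longrightarrow> (\<And>i. i < n \<Longrightarrow> x ! i \<in> carrier K) \<Longrightarrow> x \<in> vectors K n"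
  by (auto simp: vectors_def in_set_conv_nth)

lemma length_vec_ops [simp]:
  "length (vmul K n c x y) = n" "length (vapp K n a g x) = n" "length (vscale K k x) = length x"
  by (simp_all add: vmul_def vapp_def vscale_def)

lemma length_vadd: "x \<in> vectors K n \<Longrightarrow> y \<in> vectors K n \<Longrightarrow> length (vadd K x y) = n"
  by (simp add: vadd_def vectors_def)

lemma nth_vadd: "x \<in> vectors K n \<Longrightarrow> y \<in> vectors K n \<Longrightarrow> i < n \<Longrightarrow> vadd K x y ! i = x ! i \<oplus>\<^bsub>K\<^esub> y ! i"
  by (simp add: vadd_def vectors_def)

lemma nth_vscale: "i < length x \<Longrightarrow> vscale K k x ! i = k \<otimes>\<^bsub>K\<^esub> x ! i"
  by (simp add: vscale_def)

lemma nth_vmul: "k < n \<Longrightarrow> vmul K n c x y ! k =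
    vsum K n (\<lambda>j. vsum K n (\<lambda>i. x ! i \<otimes>\<^bsub>K\<^esub> c i j k) \<otimes>\<^bsub>K\<^esub> y ! j)"
  by (simp add: vmul_def)

lemma nth_vapp: "k < n \<Longrightarrow> vapp K n a g x ! k = vsum K n (\<lambda>i. x ! i \<otimes>\<^bsub>K\<^esub> a g i k)"
  by (simp add: vapp_def)

context cring
begin

lemma vadd_closed: "x \<in> vectors R n \<Longrightarrow> y \<in> vectors R n \<Longrightarrow> vadd R x y \<in> vectors R n"
  by (rule vectorsI) (auto simp: length_vadd nth_vadd nth_vectors)

lemma vscale_closed: "x \<in> vectors R n \<Longrightarrow> k \<in> carrier R \<Longrightarrow> vscale R k x \<in> vectors R n"
  by (rule vectorsI) (auto simp: nth_vscale nth_vectors length_vectors)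

context
  fixes n and c :: "nat \<Rightarrow> nat \<Rightarrow> nat \<Rightarrow> 'a"
  assumes c: "\<And>i j k. i < n \<Longrightarrow> j < n \<Longrightarrow> k < n \<Longrightarrow> c i j k \<in> carrier R"
begin

lemma vmul_closed: "x \<in> vectors R n \<Longrightarrow> y \<in> vectors R n \<Longrightarrow> vmul R n c x y \<in> vectors R n"
  by (rule vectorsI) (auto simp: nth_vmul nth_vectors c intro!: vsum_closed)

lemma vmul_vadd:
  assumes "x \<in> vectors R n" "y \<in> vectors R n" "z \<in> vectors R n"
  shows "vmul R n c x (vadd R y z) = vadd R (vmul R n c x y) (vmul R n c x z)"
proof (rule nth_equalityI)
  fix k assume k: "k < length (vmul R n c x (vadd R y z))"
  have "vmul R n c x (vadd R y z) ! k =
      vsum R n (\<lambda>j. vsum R n (\<lambda>i. x ! i \<otimes> c i j k) \<otimes> y ! j \<oplus> vsum R n (\<lambda>i. x ! i \<otimes> c i j k) \<otimes> z ! j)"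
    using k assms by (auto simp: nth_vmul nth_vadd nth_vectors c r_distr vsum_closed intro!: vsum_cong)
  also have "\<dots> = vadd R (vmul R n c x y) (vmul R n c x z) ! k"
    using k assms by (subst vsum_add) (auto simp: nth_vmul nth_vadd[OF vmul_closed vmul_closed] nth_vectors c vsum_closed)
  finally show "vmul R n c x (vadd R y z) ! k = vadd R (vmul R n c x y) (vmul R n c x z) ! k" .
qed (use assms in \<open>simp add: length_vadd[OF vmul_closed vmul_closed]\<close>)

lemma vmul_vscale:
  assumes "x \<in> vectors R n" "y \<in> vectors R n" "a \<in> carrier R"
  shows "vmul R n c x (vscale R a y) = vscale R a (vmul R n c x y)"
proof (rule nth_equalityI)
  fix k assume k: "k < length (vmul R n c x (vscale R a y))"
  have "vmul R n c x (vscale R a y) ! k =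
      vsum R n (\<lambda>j. a \<otimes> (vsum R n (\<lambda>i. x ! i \<otimes> c i j k) \<otimes> y ! j))"
    using k assms by (auto simp: nth_vmul nth_vscale length_vectors nth_vectors c vsum_closed m_ac intro!: vsum_cong)
  also have "\<dots> = vscale R a (vmul R n c x y) ! k"
    using k assms by (subst vsum_rdistr[symmetric]) (auto simp: nth_vmul nth_vscale nth_vectors c vsum_closed)
  finally show "vmul R n c x (vscale R a y) ! k = vscale R a (vmul R n c x y) ! k" .
qed simp

lemma vapp_closed: "g < n \<Longrightarrow> x \<in> vectors R n \<Longrightarrow> vapp R n c g x \<in> vectors R n"
  by (rule vectorsI) (auto simp: nth_vapp nth_vectors c intro!: vsum_closed)

lemma vapp_vadd:
  assumes "g < n" "x \<in> vectors R n" "y \<in> vectors R n"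
  shows "vapp R n c g (vadd R x y) = vadd R (vapp R n c g x) (vapp R n c g y)"
proof (rule nth_equalityI)
  fix k assume k: "k < length (vapp R n c g (vadd R x y))"
  have "vapp R n c g (vadd R x y) ! k = vsum R n (\<lambda>i. x ! i \<otimes> c g i k \<oplus> y ! i \<otimes> c g i k)"
    using k assms by (auto simp: nth_vapp nth_vadd nth_vectors c l_distr intro!: vsum_cong)
  also have "\<dots> = vadd R (vapp R n c g x) (vapp R n c g y) ! k"
    using k assms by (subst vsum_add) (auto simp: nth_vapp nth_vadd[OF vapp_closed vapp_closed] nth_vectors c)
  finally show "vapp R n c g (vadd R x y) ! k = vadd R (vapp R n c g x) (vapp R n c g y) ! k" .
qed (use assms in \<open>simp add: length_vadd[OF vapp_closed vapp_closed]\<close>)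

lemma vapp_vscale:
  assumes "g < n" "x \<in> vectors R n" "a \<in> carrier R"
  shows "vapp R n c g (vscale R a x) = vscale R a (vapp R n c g x)"
proof (rule nth_equalityI)
  fix k assume k: "k < length (vapp R n c g (vscale R a x))"
  have "vapp R n c g (vscale R a x) ! k = vsum R n (\<lambda>i. a \<otimes> (x ! i \<otimes> c g i k))"
    using k assms by (auto simp: nth_vapp nth_vscale length_vectors nth_vectors c m_assoc intro!: vsum_cong)
  also have "\<dots> = vscale R a (vapp R n c g x) ! k"
    using k assms by (subst vsum_rdistr[symmetric]) (auto simp: nth_vapp nth_vscale nth_vectors c)
  finally show "vapp R n c g (vscale R a x) ! k = vscale R a (vapp R n c g x) ! k" .
qed simp

end

end

section \<open>The algebra defined by the data, its degree and its Galois group\<close>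

definition vec_algebra :: "('a, 'b) ring_scheme \<Rightarrow> nat \<Rightarrow> (nat \<Rightarrow> nat \<Rightarrow> nat \<Rightarrow> 'a) \<Rightarrow> 'a list \<Rightarrow> 'a list ring" where
  "vec_algebra K n c u =
    \<lparr>carrier = vectors K n, monoid.mult = vmul K n c, one = u, ring.zero = replicate n \<zero>\<^bsub>K\<^esub>, ring.add = vadd K\<rparr>"

lemma vec_algebra_simps [simp]:
  "carrier (vec_algebra K n c u) = vectors K n"
  "monoid.mult (vec_algebra K n c u) = vmul K n c"
  "one (vec_algebra K n c u) = u"
  "ring.zero (vec_algebra K n c u) = replicate n \<zero>\<^bsub>K\<^esub>"
  "ring.add (vec_algebra K n c u) = vadd K"
  by (simp_all add: vec_algebra_def)

locale galois_structure = field K for K (structure) and n :: nat and lk and c a and u +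
  assumes c_closed: "\<And>i j k. i < n \<Longrightarrow> j < n \<Longrightarrow> k < n \<Longrightarrow> c i j k \<in> carrier K"
    and a_closed: "\<And>i j k. i < n \<Longrightarrow> j < n \<Longrightarrow> k < n \<Longrightarrow> a i j k \<in> carrier K"
    and u_closed: "u \<in> vectors K n"
    and data: "galois_data K n lk c a u"
begin

abbreviation L where "L \<equiv> vec_algebra K n c u"
abbreviation act where "act \<equiv> vapp K n a"
abbreviation emb where "emb k \<equiv> vscale K k u"

text \<open>All these laws sit under the same three quantifiers in \<open>galois_data\<close>, so
  uses of a law about fewer vectors fill the remaining places with dummies.\<close>

lemma mult_facts:
  assumes "x \<in> vectors K n" "y \<in> vectors K n" "z \<in> vectors K n"
  shows "vmul K n c (vmul K n c x y) z = vmul K n c x (vmul K n c y z)"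
    "vmul K n c x y = vmul K n c y x" "vmul K n c u x = x"
  using data[unfolded galois_data_def, THEN conjunct1, THEN bspec, OF assms(3), THEN bspec, OF assms(2),
      THEN bspec, OF assms(1)] by blast+

lemma act_facts:
  assumes "g < n" "x \<in> vectors K n" "y \<in> vectors K n"
  shows "act g (vmul K n c x y) = vmul K n c (act g x) (act g y)" "act g u = u"
    "h < n \<Longrightarrow> act g (act h x) = act (lk g h) x"
  using data[unfolded galois_data_def, THEN conjunct1, THEN bspec, OF assms(2), THEN bspec, OF assms(3),
      THEN bspec, OF assms(2)] assms(1) by blast+

lemma act_distinct: "g < n \<Longrightarrow> h < n \<Longrightarrow> g \<noteq> h \<Longrightarrow> \<exists>x\<in>vectors K n. act g x \<noteq> act h x"
proof -
  have *: "\<exists>x\<in>vectors K n. act g x \<noteq> act h x" if "g < n" "h < g" for g h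
    using data that unfolding galois_data_def by simp
  assume "g < n" "h < n" "g \<noteq> h"
  then consider "h < g" | "g < h" by linarith
  then show ?thesis
    using *[of g h] *[of h g, THEN bexE, of ?thesis] \<open>g < n\<close> \<open>h < n\<close> by cases (blast, metis)
qed

lemma zero_vec: "replicate n \<zero>\<^bsub>K\<^esub> \<in> vectors K n"
  by (auto simp: vectors_def)

text \<open>The additive laws hold coordinatewise and distributivity is bilinearity of
  \<open>vmul\<close>; everything else, including inverses, is demanded by
  \<open>data\<close>.\<close>

lemma field_L: "field L"
proof -
  have "cring L"
  proof (rule cringI)
    show "abelian_group L"
    proof (rule abelian_groupI)
      fix x assume x: "x \<in> carrier L"
      let ?y = "map (\<lambda>a. \<ominus> a) x"
      have y: "?y \<in> vectors K n" using x by (auto simp: vectors_def)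
      have "vadd K ?y x = replicate n \<zero>"
        using x y by (intro nth_equalityI) (auto simp: length_vadd nth_vadd nth_vectors length_vectors l_neg)
      then show "\<exists>y\<in>carrier L. y \<oplus>\<^bsub>L\<^esub> x = \<zero>\<^bsub>L\<^esub>" using y by auto
    next
      fix x y z assume "x \<in> carrier L" "y \<in> carrier L" "z \<in> carrier L"
      then have xyz: "x \<in> vectors K n" "y \<in> vectors K n" "z \<in> vectors K n" by auto
      note cl = vadd_closed[OF xyz(1,2)] vadd_closed[OF xyz(2,3)]
      show "(x \<oplus>\<^bsub>L\<^esub> y) \<oplus>\<^bsub>L\<^esub> z = x \<oplus>\<^bsub>L\<^esub> (y \<oplus>\<^bsub>L\<^esub> z)"
        using xyz cl length_vadd[OF cl(1) xyz(3)] length_vadd[OF xyz(1) cl(2)]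
        by (auto simp: nth_vadd nth_vectors a_ac intro!: nth_equalityI)
    next
      fix x assume "x \<in> carrier L"
      then show "\<zero>\<^bsub>L\<^esub> \<oplus>\<^bsub>L\<^esub> x = x"
        using length_vadd[OF zero_vec, of x] nth_vadd[OF zero_vec, of x]
        by (auto simp: nth_vectors length_vectors intro!: nth_equalityI)
    qed (auto simp: vadd_closed zero_vec length_vadd nth_vadd nth_vectors a_ac
          intro!: nth_equalityI)
    show "comm_monoid L"
    proof (rule comm_monoidI)
      fix x y z assume "x \<in> carrier L" "y \<in> carrier L" "z \<in> carrier L"
      then show "x \<otimes>\<^bsub>L\<^esub> y \<otimes>\<^bsub>L\<^esub> z = x \<otimes>\<^bsub>L\<^esub> (y \<otimes>\<^bsub>L\<^esub> z)" using mult_facts(1) by simp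
    next
      fix x y assume "x \<in> carrier L" "y \<in> carrier L"
      then show "x \<otimes>\<^bsub>L\<^esub> y = y \<otimes>\<^bsub>L\<^esub> x" "\<one>\<^bsub>L\<^esub> \<otimes>\<^bsub>L\<^esub> x = x"
        using mult_facts(2,3) by simp_all
    qed (use vmul_closed[OF c_closed] u_closed in auto)
    show "(x \<oplus>\<^bsub>L\<^esub> y) \<otimes>\<^bsub>L\<^esub> z = x \<otimes>\<^bsub>L\<^esub> z \<oplus>\<^bsub>L\<^esub> y \<otimes>\<^bsub>L\<^esub> z"
      if "x \<in> carrier L" "y \<in> carrier L" "z \<in> carrier L" for x y z
      using that vmul_vadd[OF c_closed, where n = n and x = z and y = x and z = y]
        mult_facts(2)[of "vadd K x y" z z] mult_facts(2)[of x z z] mult_facts(2)[of y z z]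
      by (simp add: vadd_closed)
  qed
  then show ?thesis
  proof (rule cring.cring_fieldI2)
    show "\<zero>\<^bsub>L\<^esub> \<noteq> \<one>\<^bsub>L\<^esub>"
      using data[unfolded galois_data_def, THEN conjunct2, THEN conjunct1] by simp
    show "\<exists>y\<in>carrier L. x \<otimes>\<^bsub>L\<^esub> y = \<one>\<^bsub>L\<^esub>" if "x \<in> carrier L" "x \<noteq> \<zero>\<^bsub>L\<^esub>" for x
      using data[unfolded galois_data_def, THEN conjunct2, THEN conjunct2, THEN conjunct1] that by auto
  qed
qed

sublocale L: field L
  by (rule field_L)

lemma emb_mult:
  assumes "k \<in> carrier K" "x \<in> vectors K n"
  shows "vmul K n c (emb k) x = vscale K k x"
  using assms mult_facts(2)[of "emb k" x x] mult_facts(2)[of x u x] mult_facts(3)[of x x x]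
    vmul_vscale[OF c_closed, where n = n and x = x and y = u and a = k] u_closed
  by (simp add: vscale_closed)

lemma emb_hom: "emb \<in> ring_hom K L"
proof (rule ring_hom_memI)
  fix k l assume kl: "k \<in> carrier K" "l \<in> carrier K"
  show "emb k \<in> carrier L" using kl u_closed by (simp add: vscale_closed)
  show "emb (k \<otimes> l) = emb k \<otimes>\<^bsub>L\<^esub> emb l"
    using kl u_closed emb_mult[of k "emb l"]
    by (auto simp: vscale_closed nth_vscale nth_vectors length_vectors m_assoc intro!: nth_equalityI)
  show "emb (k \<oplus> l) = emb k \<oplus>\<^bsub>L\<^esub> emb l"
    using kl u_closed vscale_closed[OF u_closed kl(1)] vscale_closed[OF u_closed kl(2)]
    by (auto simp: nth_vadd length_vadd nth_vscale nth_vectors length_vectors l_distr intro!: nth_equalityI)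
next
  show "emb \<one> = \<one>\<^bsub>L\<^esub>"
    using u_closed by (auto simp: nth_vscale nth_vectors length_vectors intro!: nth_equalityI)
qed

lemma act_hom: "g < n \<Longrightarrow> act g \<in> ring_hom L L"
  using vapp_closed[OF a_closed] vapp_vadd[OF a_closed] act_facts u_closed
  by (intro ring_hom_memI) auto

lemma act_emb: "g < n \<Longrightarrow> k \<in> carrier K \<Longrightarrow> act g (emb k) = emb k"
  using vapp_vscale[OF a_closed, where n = n and g = g and x = u and a = k] act_facts(2)[of g u u] u_closed by simp

lemma subfield_emb: "subfield (emb ` carrier K) L"
proof -
  interpret emb: ring_hom_ring K L emb
    by (rule ring_hom_ringI2[OF ring_axioms L.ring_axioms emb_hom])
  show ?thesis using emb.img_is_subfield(2)[OF carrier_is_subfield] L.one_not_zero by simp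
qed

lemma dimension_L: "L.dimension n (emb ` carrier K) (carrier L)"
proof -
  \<comment> \<open>Dimension is built up by line extensions, so \<open>L\<close> is exhausted by
    the flag of the spaces \<open>E m\<close> of vectors supported on the first \<open>m\<close>
    coordinates, where the standard basis vector \<open>b m\<close> leads from \<open>E m\<close> to
    \<open>E (Suc m)\<close>.\<close>
  define E where "E m = {x \<in> vectors K n. \<forall>i<n. m \<le> i \<longrightarrow> x ! i = \<zero>}" for m
  define b where "b m = (replicate n \<zero>)[m := \<one>]" for m
  have b: "b m \<in> vectors K n" for m
    by (rule vectorsI; cases "m < n") (auto simp: b_def nth_list_update)
  have "m \<le> n \<Longrightarrow> L.dimension m (emb ` carrier K) (E m)" for m
  proof (induction m)
    case 0
    have "E 0 = {\<zero>\<^bsub>L\<^esub>}"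
      using zero_vec by (auto simp: E_def length_vectors intro: nth_equalityI)
    then show ?case using L.zero_dim by simp
  next
    case (Suc m)
    have "L.line_extension (emb ` carrier K) (b m) (E m) = E (Suc m)"
    proof
      show "L.line_extension (emb ` carrier K) (b m) (E m) \<subseteq> E (Suc m)"
      proof
        fix x assume "x \<in> L.line_extension (emb ` carrier K) (b m) (E m)"
        then obtain k y where ky: "k \<in> carrier K" "y \<in> E m" "x = vadd K (vscale K k (b m)) y"
          using b by (auto simp: L.line_extension_mem_iff emb_mult)
        then have y: "y \<in> vectors K n" by (simp add: E_def)
        have kb: "vscale K k (b m) \<in> vectors K n" using ky(1) b by (simp add: vscale_closed)
        show "x \<in> E (Suc m)"
          using ky y kb b vadd_closed[OF kb y]
          by (auto simp: E_def nth_vadd nth_vscale length_vectors b_def nth_list_update)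
      qed
      show "E (Suc m) \<subseteq> L.line_extension (emb ` carrier K) (b m) (E m)"
      proof
        fix x assume x: "x \<in> E (Suc m)"
        then have xv: "x \<in> vectors K n" by (simp add: E_def)
        have k: "x ! m \<in> carrier K" using xv Suc.prems by (auto intro: nth_vectors)
        have y: "x[m := \<zero>] \<in> vectors K n"
          using xv Suc.prems by (auto intro!: vectorsI simp: nth_list_update nth_vectors length_vectors)
        have kb: "vscale K (x ! m) (b m) \<in> vectors K n" using k b by (simp add: vscale_closed)
        have "x = vadd K (vscale K (x ! m) (b m)) (x[m := \<zero>])"
          using xv y kb b k Suc.prems by (intro nth_equalityI)
            (auto simp: length_vadd nth_vadd nth_vscale length_vectors nth_vectors b_def nth_list_update)
        moreover have "x[m := \<zero>] \<in> E m"
          using x y by (auto simp: E_def nth_list_update length_vectors not_less_eq_eq)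
        ultimately show "x \<in> L.line_extension (emb ` carrier K) (b m) (E m)"
          using k b by (auto simp: L.line_extension_mem_iff emb_mult intro!: bexI[of _ "x ! m"] bexI[of _ "x[m := \<zero>]"])
      qed
    qed
    moreover have "b m \<notin> E m" using Suc.prems by (auto simp: E_def b_def intro!: exI[of _ m])
    ultimately show ?case using Suc L.Suc_dim[of "b m" "E m" m "emb ` carrier K"] b by simp
  qed
  from this[of n] show ?thesis by (simp add: E_def)
qed


lemma galois_extension_L:
  assumes "n > 0"
  shows "galois_extension L (emb ` carrier K)"
  by (rule L.enough_homs_imp_galois[OF subfield_emb, of "{..<n}" act])
    (use dimension_L act_hom act_distinct act_emb assms in auto)

lemma L_hom_is_act:
  assumes "s \<in> ring_hom L L" "\<And>k. k \<in> emb ` carrier K \<Longrightarrow> s k = k"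
  shows "\<exists>g<n. \<forall>x\<in>vectors K n. s x = act g x"
proof -
  have "\<exists>g\<in>{..<n}. \<forall>x\<in>carrier L. s x = act g x"
    by (rule L.hom_in_full_family[OF subfield_emb])
      (use dimension_L act_hom act_distinct act_emb assms in auto)
  then show ?thesis by auto
qed

lemma galois_group_iso:
  assumes G: "group G" and xs: "distinct xs" "set xs = carrier G" "length xs = n"
    and lk: "\<And>g h. g < n \<Longrightarrow> h < n \<Longrightarrow> lk g h < n \<and> xs ! lk g h = xs ! g \<otimes>\<^bsub>G\<^esub> xs ! h"
  shows "galois_group L (emb ` carrier K) \<cong> G"
proof -
  interpret G: group G by fact
  define ix where "ix x = (SOME i. i < n \<and> xs ! i = x)" for x
  have ix: "ix x < n \<and> xs ! ix x = x" if "x \<in> carrier G" for x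
    unfolding ix_def by (rule someI_ex) (metis that xs(2,3) in_set_conv_nth)
  have nth_inj: "i = j" if "i < n" "j < n" "xs ! i = xs ! j" for i j
    using that xs(1,3) by (simp add: nth_eq_iff_index_eq)
  have xs_in: "xs ! i \<in> carrier G" if "i < n" for i using that xs(2,3) by (metis nth_mem)
  have ix_mult: "ix (x \<otimes>\<^bsub>G\<^esub> y) = lk (ix x) (ix y)" if "x \<in> carrier G" "y \<in> carrier G" for x y
    using that ix[of x] ix[of y] ix[of "x \<otimes>\<^bsub>G\<^esub> y"] lk[of "ix x" "ix y"] by (intro nth_inj) auto
  define f where "f x = act (ix x)" for x
  have f_mult: "f (x \<otimes>\<^bsub>G\<^esub> y) v = f x (f y v)"
    if "x \<in> carrier G" "y \<in> carrier G" "v \<in> vectors K n" for x y v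
    using that ix_mult act_facts(3)[of "ix x" v v "ix y"] ix by (simp add: f_def)
  have f_hom: "f x \<in> ring_hom L L" if "x \<in> carrier G" for x
    using that ix act_hom by (simp add: f_def)
  have f_closed: "f x v \<in> vectors K n" if "x \<in> carrier G" "v \<in> vectors K n" for x v
    using ring_hom_closed[OF f_hom[OF that(1)], of v] that(2) by simp
  \<comment> \<open>That the unit of \<open>G\<close> acts as the identity is not among the axioms.
    Its operator is an idempotent field homomorphism, and field homomorphisms are injective, so it
    fixes every vector.\<close>
  have f_one: "f \<one>\<^bsub>G\<^esub> v = v" if v: "v \<in> vectors K n" for v
  proof -
    have "inj_on (f \<one>\<^bsub>G\<^esub>) (carrier L)"
      using non_trivial_field_hom_is_inj[OF f_hom[OF G.one_closed] field_L field_L] by simp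
    moreover have "f \<one>\<^bsub>G\<^esub> (f \<one>\<^bsub>G\<^esub> v) = f \<one>\<^bsub>G\<^esub> v"
      using f_mult[of "\<one>\<^bsub>G\<^esub>" "\<one>\<^bsub>G\<^esub>" v] v by simp
    ultimately show ?thesis using v f_closed by (auto simp: inj_on_def)
  qed
  have f_bij: "bij_betw (f x) (vectors K n) (vectors K n)" if x: "x \<in> carrier G" for x
  proof (rule bij_betw_byWitness[where f' = "f (inv\<^bsub>G\<^esub> x)"])
    show "\<forall>v\<in>vectors K n. f (inv\<^bsub>G\<^esub> x) (f x v) = v" "\<forall>v\<in>vectors K n. f x (f (inv\<^bsub>G\<^esub> x) v) = v"
      using f_mult[of x "inv\<^bsub>G\<^esub> x"] f_mult[of "inv\<^bsub>G\<^esub> x" x] f_one x by auto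
  qed (use f_closed x in auto)
  \<comment> \<open>Members of \<open>Bij\<close> are extensional functions, hence the restriction
    to the carrier.\<close>
  define \<theta> where "\<theta> x = restrict (f x) (vectors K n)" for x
  have \<theta>_Bij: "\<theta> x \<in> Bij (vectors K n)" if "x \<in> carrier G" for x
    using f_bij[OF that] by (auto simp: Bij_def \<theta>_def cong: bij_betw_cong)
  have \<theta>_hom: "\<theta> x \<in> ring_hom L L" if "x \<in> carrier G" for x
    using L.ring_hom_restrict[OF f_hom[OF that], of "\<theta> x"] by (simp add: \<theta>_def)
  have emb_closed: "emb k \<in> vectors K n" if "k \<in> carrier K" for k
    using that u_closed by (simp add: vscale_closed)
  have car: "carrier (galois_group L (emb ` carrier K)) =
      {s \<in> Bij (vectors K n). s \<in> ring_hom L L \<and> (\<forall>x\<in>emb ` carrier K. s x = x)}"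
    by (simp add: galois_group_def)
  have \<theta>_in: "\<theta> x \<in> carrier (galois_group L (emb ` carrier K))" if "x \<in> carrier G" for x
    unfolding car using that \<theta>_Bij \<theta>_hom act_emb ix emb_closed by (auto simp: \<theta>_def f_def)
  have "\<theta> \<in> iso G (galois_group L (emb ` carrier K))"
  proof (rule isoI)
    show "\<theta> \<in> hom G (galois_group L (emb ` carrier K))"
    proof (rule homI)
      fix x y assume xy: "x \<in> carrier G" "y \<in> carrier G"
      then have "\<theta> (x \<otimes>\<^bsub>G\<^esub> y) = compose (vectors K n) (\<theta> x) (\<theta> y)"
        using f_mult f_closed by (auto simp: \<theta>_def compose_def)
      then show "\<theta> (x \<otimes>\<^bsub>G\<^esub> y) = \<theta> x \<otimes>\<^bsub>galois_group L (emb ` carrier K)\<^esub> \<theta> y"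
        using \<theta>_Bij xy by (simp add: galois_group_def BijGroup_def)
    qed (rule \<theta>_in)
    have "inj_on \<theta> (carrier G)"
    proof (rule inj_onI)
      fix x y assume xy: "x \<in> carrier G" "y \<in> carrier G" "\<theta> x = \<theta> y"
      have "act (ix x) v = act (ix y) v" if "v \<in> vectors K n" for v
        using fun_cong[OF xy(3), of v] that by (simp add: \<theta>_def f_def)
      then have "ix x = ix y" using act_distinct[of "ix x" "ix y"] ix xy by blast
      then show "x = y" using ix[OF xy(1)] ix[OF xy(2)] by metis
    qed
    moreover have "\<theta> ` carrier G = carrier (galois_group L (emb ` carrier K))"
    proof
      show "carrier (galois_group L (emb ` carrier K)) \<subseteq> \<theta> ` carrier G"
      proof
        fix s assume s: "s \<in> carrier (galois_group L (emb ` carrier K))"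
        then obtain g where g: "g < n" "\<forall>x\<in>vectors K n. s x = act g x"
          using L_hom_is_act[of s] unfolding car by blast
        have "ix (xs ! g) = g" using ix[OF xs_in[OF g(1)]] g(1) nth_inj by blast
        moreover have "s \<in> extensional (vectors K n)" using s unfolding car by (simp add: Bij_def)
        ultimately have "s = \<theta> (xs ! g)"
          using g(2) by (intro extensionalityI[of s "vectors K n"]) (auto simp: \<theta>_def f_def)
        then show "s \<in> \<theta> ` carrier G" using xs_in[OF g(1)] by blast
      qed
    qed (use \<theta>_in in auto)
    ultimately show "bij_betw \<theta> (carrier G) (carrier (galois_group L (emb ` carrier K)))"
      by (simp add: bij_betw_def)
  qed
  \<comment> \<open>\<open>\<theta>\<close> leads from \<open>G\<close> to the Galois group, so the
    isomorphism is turned around.\<close>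
  then show ?thesis using G.iso_set_sym by (auto simp: is_iso_def)
qed

end

lemma galois_data_imp_IGP:
  fixes K :: "('a, 'b) ring_scheme"
  assumes "galois_structure K n lk c a u"
    and G: "group G" and xs: "distinct xs" "set xs = carrier G" "length xs = n"
    and lk: "\<And>g h. g < n \<Longrightarrow> h < n \<Longrightarrow> lk g h < n \<and> xs ! lk g h = xs ! g \<otimes>\<^bsub>G\<^esub> xs ! h"
  shows "IGP K G"
proof -
  interpret galois_structure K n lk c a u by fact
  interpret G: group G by fact
  have "order G = n" using xs by (metis order_def distinct_card)
  moreover have "n > 0" using xs by (metis G.one_closed length_pos_if_in_set)
  ultimately show ?thesis
    unfolding IGP_def
    using emb_hom galois_extension_L dimension_L galois_group_iso[OF G xs lk] by blast
qed


section \<open>From a Galois extension to a model of the sentence\<close>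

text \<open>\<open>combine\<close> recurses from the front and \<open>vsum\<close> from the back;
  induction over the common prefixes of both lists reconciles them.\<close>

lemma (in ring) combine_eq_vsum:
  assumes "length Ks = length Us" "set Ks \<subseteq> carrier R" "set Us \<subseteq> carrier R"
  shows "combine Ks Us = vsum R (length Us) (\<lambda>i. Ks ! i \<otimes> Us ! i)"
proof -
  have "m \<le> length Us \<Longrightarrow> combine (take m Ks) (take m Us) = vsum R m (\<lambda>i. Ks ! i \<otimes> Us ! i)" for m
  proof (induction m)
    case (Suc m)
    have c: "Ks ! m \<in> carrier R" "Us ! m \<in> carrier R" using Suc.prems assms by auto
    have t: "set (take m Ks) \<subseteq> carrier R" "set (take m Us) \<subseteq> carrier R"
      using assms set_take_subset by fast+
    have "combine (take (Suc m) Ks) (take (Suc m) Us)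
        = combine (take m Ks) (take m Us) \<oplus> combine [Ks ! m] [Us ! m]"
      using Suc.prems assms(1) c t
      by (simp add: take_Suc_conv_app_nth combine_append[symmetric] del: combine.simps)
    then show ?case using Suc c combine_in_carrier[OF t] by (simp add: a_comm)
  qed simp
  from this[of "length Us"] show ?thesis using assms(1) by simp
qed

text \<open>Only entries with indices below \<open>n\<close> are ever read. This allows cubes
  flattened into lists, which agree with the given functions just there.\<close>

lemma galois_data_cong:
  assumes "\<And>i j k. i < n \<Longrightarrow> j < n \<Longrightarrow> k < n \<Longrightarrow> c i j k = c' i j k"
    "\<And>i j k. i < n \<Longrightarrow> j < n \<Longrightarrow> k < n \<Longrightarrow> a i j k = a' i j k"
    and lk: "\<And>g h. g < n \<Longrightarrow> h < n \<Longrightarrow> lk g h < n"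
  shows "galois_data K n lk c a u \<longleftrightarrow> galois_data K n lk c' a' u"
proof -
  have "vmul K n c = vmul K n c'" using assms(1) by (rule vmul_cong)
  moreover have "vapp K n a g = vapp K n a' g" if "g < n" for g
    using assms(2) that by (intro vapp_cong) auto
  ultimately show ?thesis using lk by (auto simp: galois_data_def)
qed

text \<open>The converse situation: an extension along \<open>h\<close> with a list of
  \<open>n\<close> distinct homomorphisms fixing the image of \<open>K\<close> and closed under
  composition. Choosing a base turns it into numerical data.\<close>

locale galois_coordinates = K: field K + L: field L + ring_hom_ring K L h
  for K :: "('a, 'b) ring_scheme" and L :: "('l, 'm) ring_scheme" and h +
  fixes n :: nat and s :: "nat \<Rightarrow> 'l \<Rightarrow> 'l" and lk :: "nat \<Rightarrow> nat \<Rightarrow> nat"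
  assumes dim: "L.dimension n (h ` carrier K) (carrier L)"
    and s_hom: "\<And>g. g < n \<Longrightarrow> s g \<in> ring_hom L L"
    and s_fix: "\<And>g k. g < n \<Longrightarrow> k \<in> carrier K \<Longrightarrow> s g (h k) = h k"
    and s_distinct: "\<And>g h. g < n \<Longrightarrow> h < n \<Longrightarrow> g \<noteq> h \<Longrightarrow> \<exists>x\<in>carrier L. s g x \<noteq> s h x"
    and s_comp: "\<And>g h x. g < n \<Longrightarrow> h < n \<Longrightarrow> x \<in> carrier L \<Longrightarrow> s g (s h x) = s (lk g h) x"
    and lk: "\<And>g h. g < n \<Longrightarrow> h < n \<Longrightarrow> lk g h < n"
begin

definition base where
  "base = (SOME Vs. set Vs \<subseteq> carrier L \<and> L.independent (h ` carrier K) Vs \<and> length Vs = n \<and>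
    L.Span (h ` carrier K) Vs = carrier L)"

lemma subfield_h: "subfield (h ` carrier K) L"
  using img_is_subfield(2)[OF K.carrier_is_subfield L.one_not_zero] .

lemma base: "set base \<subseteq> carrier L" "L.independent (h ` carrier K) base" "length base = n"
    "L.Span (h ` carrier K) base = carrier L"
  using someI_ex[OF L.exists_base[OF subfield_h dim]] unfolding base_def by blast+

lemma base_nth: "i < n \<Longrightarrow> base ! i \<in> carrier L"
  using base by auto

text \<open>The coordinate isomorphism from \<open>K^n\<close> to \<open>L\<close>. It carries
  \<open>vmul\<close> and \<open>vapp\<close> to the operations of \<open>L\<close>, so each
  required law can be checked in \<open>L\<close> and pulled back by injectivity.\<close>

definition lin :: "'a list \<Rightarrow> 'l" where
  "lin v = vsum L n (\<lambda>i. h (v ! i) \<otimes>\<^bsub>L\<^esub> base ! i)"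

lemma lin_closed: "v \<in> vectors K n \<Longrightarrow> lin v \<in> carrier L"
  unfolding lin_def by (intro L.vsum_closed) (auto simp: nth_vectors base_nth)

lemma lin_eq_combine: "v \<in> vectors K n \<Longrightarrow> lin v = L.combine (map h v) base"
  using base by (subst L.combine_eq_vsum) (auto simp: vectors_def lin_def intro!: vsum_cong)

lemma h_inj: "inj_on h (carrier K)"
  using non_trivial_field_hom_is_inj[OF homh K.field_axioms L.field_axioms] .

text \<open>Decomposition along the base is unique with coefficients in the image of
  \<open>h\<close>; injectivity of \<open>h\<close> moves the coefficients back to
  \<open>K\<close>.\<close>

lemma lin_bij: "bij_betw lin (vectors K n) (carrier L)"
proof (rule bij_betw_imageI)
  have uni: "\<exists>!Ks. set Ks \<subseteq> h ` carrier K \<and> length Ks = n \<and> y = L.combine Ks base" if "y \<in> carrier L" for y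
    using L.unique_decomposition[OF subfield_h base(2), of y] that base by simp
  show "inj_on lin (vectors K n)"
  proof (rule inj_onI)
    fix v w assume vw: "v \<in> vectors K n" "w \<in> vectors K n" "lin v = lin w"
    have "set (map h v) \<subseteq> h ` carrier K \<and> length (map h v) = n \<and> lin v = L.combine (map h v) base"
      "set (map h w) \<subseteq> h ` carrier K \<and> length (map h w) = n \<and> lin v = L.combine (map h w) base"
      using vw lin_eq_combine[of v] lin_eq_combine[of w] by (auto simp: vectors_def)
    then have "map h v = map h w"
      using uni[OF lin_closed[OF vw(1)]] by blast
    moreover have "inj_on h (set v \<union> set w)"
      using inj_on_subset[OF h_inj] vw by (auto simp: vectors_def)
    ultimately show "v = w" by (simp add: inj_on_map_eq_map)
  qed
  show "lin ` vectors K n = carrier L"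
  proof
    show "carrier L \<subseteq> lin ` vectors K n"
    proof
      fix y assume "y \<in> carrier L"
      then obtain Ks where Ks: "set Ks \<subseteq> h ` carrier K" "length Ks = n" "y = L.combine Ks base"
        using uni by blast
      define v where "v = map (inv_into (carrier K) h) Ks"
      have "map h v = Ks" "set v \<subseteq> carrier K"
        using Ks(1) by (auto simp: v_def f_inv_into_f inv_into_into intro!: map_idI)
      with Ks have "v \<in> vectors K n" "y = lin v" using lin_eq_combine[of v] by (auto simp: vectors_def)
      then show "y \<in> lin ` vectors K n" by blast
    qed
  qed (auto simp: lin_closed)
qed

lemma lin_eq_iff: "v \<in> vectors K n \<Longrightarrow> w \<in> vectors K n \<Longrightarrow> lin v = lin w \<longleftrightarrow> v = w"
  using lin_bij by (auto simp: bij_betw_def inj_on_eq_iff)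

definition coords where "coords = inv_into (vectors K n) lin"

lemma coords: "y \<in> carrier L \<Longrightarrow> coords y \<in> vectors K n" "y \<in> carrier L \<Longrightarrow> lin (coords y) = y"
  using lin_bij unfolding coords_def
  by (auto simp: bij_betw_def inv_into_into f_inv_into_f)

definition struct_consts where "struct_consts i j k = coords (base ! i \<otimes>\<^bsub>L\<^esub> base ! j) ! k"
definition act_matrices where "act_matrices g i k = coords (s g (base ! i)) ! k"

lemma s_closed: "g < n \<Longrightarrow> x \<in> carrier L \<Longrightarrow> s g x \<in> carrier L"
  using ring_hom_closed[OF s_hom] .

lemma struct_consts_closed: "i < n \<Longrightarrow> j < n \<Longrightarrow> k < n \<Longrightarrow> struct_consts i j k \<in> carrier K"
  unfolding struct_consts_def by (rule nth_vectors[OF coords(1)[OF L.m_closed[OF base_nth base_nth]]])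

lemma act_matrices_closed: "i < n \<Longrightarrow> j < n \<Longrightarrow> k < n \<Longrightarrow> act_matrices i j k \<in> carrier K"
  unfolding act_matrices_def by (rule nth_vectors[OF coords(1)[OF s_closed[OF _ base_nth]]])

lemma vapp_in: "g < n \<Longrightarrow> x \<in> vectors K n \<Longrightarrow> vapp K n act_matrices g x \<in> vectors K n"
  by (rule K.vapp_closed[OF act_matrices_closed])

lemma vmul_in: "x \<in> vectors K n \<Longrightarrow> y \<in> vectors K n \<Longrightarrow> vmul K n struct_consts x y \<in> vectors K n"
  by (rule K.vmul_closed[OF struct_consts_closed])

lemma sum_struct_consts: "i < n \<Longrightarrow> j < n \<Longrightarrow> vsum L n (\<lambda>k. h (struct_consts i j k) \<otimes>\<^bsub>L\<^esub> base ! k) = base ! i \<otimes>\<^bsub>L\<^esub> base ! j"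
  using coords(2)[of "base ! i \<otimes>\<^bsub>L\<^esub> base ! j"] base_nth by (simp add: lin_def struct_consts_def)

lemma sum_act_matrices: "g < n \<Longrightarrow> i < n \<Longrightarrow> vsum L n (\<lambda>k. h (act_matrices g i k) \<otimes>\<^bsub>L\<^esub> base ! k) = s g (base ! i)"
  using coords(2)[of "s g (base ! i)"] base_nth s_closed by (simp add: lin_def act_matrices_def)

text \<open>Both sides are linear over the image of \<open>K\<close>, as \<open>s g\<close> fixes
  it, so after exchanging the sums it suffices to know the images of the base vectors, which are
  what the matrices record.\<close>

lemma lin_vapp:
  assumes g: "g < n" and x: "x \<in> vectors K n"
  shows "lin (vapp K n act_matrices g x) = s g (lin x)"
proof -
  interpret sg: ring_hom_ring L L "s g"
    by (rule ring_hom_ringI2[OF L.ring_axioms L.ring_axioms s_hom[OF g]])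
  note cl = nth_vectors[OF x] base_nth act_matrices_closed[OF g]
  have "lin (vapp K n act_matrices g x) = vsum L n (\<lambda>k. vsum L n (\<lambda>i. h (x ! i) \<otimes>\<^bsub>L\<^esub> (h (act_matrices g i k) \<otimes>\<^bsub>L\<^esub> base ! k)))"
    unfolding lin_def using cl
    by (auto simp: nth_vapp hom_vsum L.vsum_ldistr L.m_assoc intro!: vsum_cong)
  also have "\<dots> = vsum L n (\<lambda>i. vsum L n (\<lambda>k. h (x ! i) \<otimes>\<^bsub>L\<^esub> (h (act_matrices g i k) \<otimes>\<^bsub>L\<^esub> base ! k)))"
    using cl by (intro L.vsum_swap) auto
  also have "\<dots> = vsum L n (\<lambda>i. h (x ! i) \<otimes>\<^bsub>L\<^esub> s g (base ! i))"
    using cl g by (intro vsum_cong refl) (auto simp: L.vsum_rdistr[symmetric] sum_act_matrices)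
  also have "\<dots> = s g (lin x)"
    unfolding lin_def using cl g by (auto simp: sg.hom_vsum s_fix intro!: vsum_cong)
  finally show ?thesis .
qed

lemma lin_vmul:
  assumes x: "x \<in> vectors K n" and y: "y \<in> vectors K n"
  shows "lin (vmul K n struct_consts x y) = lin x \<otimes>\<^bsub>L\<^esub> lin y"
proof -
  note cl = nth_vectors[OF x] nth_vectors[OF y] base_nth struct_consts_closed
  have "lin (vmul K n struct_consts x y) =
      vsum L n (\<lambda>k. vsum L n (\<lambda>j. vsum L n (\<lambda>i.
        h (x ! i) \<otimes>\<^bsub>L\<^esub> h (y ! j) \<otimes>\<^bsub>L\<^esub> (h (struct_consts i j k) \<otimes>\<^bsub>L\<^esub> base ! k))))"
    unfolding lin_def
  proof (rule vsum_cong[OF refl])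
    fix k assume k: "k < n"
    have "h (vmul K n struct_consts x y ! k) =
        vsum L n (\<lambda>j. vsum L n (\<lambda>i. h (x ! i) \<otimes>\<^bsub>L\<^esub> h (struct_consts i j k)) \<otimes>\<^bsub>L\<^esub> h (y ! j))"
      using cl k by (simp add: nth_vmul hom_vsum K.vsum_closed cong: vsum_cong)
    then have "h (vmul K n struct_consts x y ! k) \<otimes>\<^bsub>L\<^esub> base ! k =
        vsum L n (\<lambda>j. vsum L n (\<lambda>i. h (x ! i) \<otimes>\<^bsub>L\<^esub> h (struct_consts i j k) \<otimes>\<^bsub>L\<^esub> h (y ! j) \<otimes>\<^bsub>L\<^esub> base ! k))"
      using cl k by (simp add: L.vsum_ldistr L.vsum_closed cong: vsum_cong)
    also have "\<dots> = vsum L n (\<lambda>j. vsum L n (\<lambda>i.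
        h (x ! i) \<otimes>\<^bsub>L\<^esub> h (y ! j) \<otimes>\<^bsub>L\<^esub> (h (struct_consts i j k) \<otimes>\<^bsub>L\<^esub> base ! k)))"
      using cl k by (intro vsum_cong refl) (simp add: L.m_ac)
    finally show "h (vmul K n struct_consts x y ! k) \<otimes>\<^bsub>L\<^esub> base ! k = \<dots>" .
  qed
  \<comment> \<open>The sum over \<open>k\<close> is moved innermost in two exchanges, where
    \<open>sum_struct_consts\<close> collapses it to a product of two base vectors.\<close>
  also have "\<dots> = vsum L n (\<lambda>j. vsum L n (\<lambda>k. vsum L n (\<lambda>i.
        h (x ! i) \<otimes>\<^bsub>L\<^esub> h (y ! j) \<otimes>\<^bsub>L\<^esub> (h (struct_consts i j k) \<otimes>\<^bsub>L\<^esub> base ! k))))"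
    using cl by (intro L.vsum_swap) (auto intro!: L.vsum_closed)
  also have "\<dots> = vsum L n (\<lambda>j. vsum L n (\<lambda>i. vsum L n (\<lambda>k.
        h (x ! i) \<otimes>\<^bsub>L\<^esub> h (y ! j) \<otimes>\<^bsub>L\<^esub> (h (struct_consts i j k) \<otimes>\<^bsub>L\<^esub> base ! k))))"
    using cl by (intro vsum_cong refl L.vsum_swap) auto
  also have "\<dots> = vsum L n (\<lambda>j. vsum L n (\<lambda>i.
        h (x ! i) \<otimes>\<^bsub>L\<^esub> h (y ! j) \<otimes>\<^bsub>L\<^esub> (base ! i \<otimes>\<^bsub>L\<^esub> base ! j)))"
    using cl by (intro vsum_cong refl) (auto simp: L.vsum_rdistr[symmetric] sum_struct_consts)
  also have "\<dots> = vsum L n (\<lambda>j. lin x \<otimes>\<^bsub>L\<^esub> (h (y ! j) \<otimes>\<^bsub>L\<^esub> base ! j))"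
    unfolding lin_def using cl by (auto simp: L.vsum_ldistr L.m_ac intro!: vsum_cong)
  also have "\<dots> = lin x \<otimes>\<^bsub>L\<^esub> lin y"
    unfolding lin_def[of y] using cl lin_closed[OF x] by (subst L.vsum_rdistr) auto
  finally show ?thesis .
qed

lemma lin_zero: "lin (replicate n \<zero>\<^bsub>K\<^esub>) = \<zero>\<^bsub>L\<^esub>"
proof -
  have "lin (replicate n \<zero>\<^bsub>K\<^esub>) = vsum L n (\<lambda>i. \<zero>\<^bsub>L\<^esub>)"
    unfolding lin_def by (intro vsum_cong) (auto simp: base_nth)
  then show ?thesis by (simp add: L.vsum_zero)
qed

lemma galois_structure: "galois_structure K n lk struct_consts act_matrices (coords \<one>\<^bsub>L\<^esub>)"
proof (unfold_locales)
  let ?u = "coords \<one>\<^bsub>L\<^esub>"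
  let ?V = "vectors K n"
  have u: "?u \<in> ?V" "lin ?u = \<one>\<^bsub>L\<^esub>" using coords[OF L.one_closed] by auto
  have zero: "replicate n \<zero>\<^bsub>K\<^esub> \<in> ?V" by (auto simp: vectors_def)
  have eqI: "v = w" if "lin v = lin w" "v \<in> ?V" "w \<in> ?V" for v w using that lin_eq_iff by blast
  show "galois_data K n lk struct_consts act_matrices ?u"
    unfolding galois_data_def
  proof (intro conjI ballI allI impI)
    fix x y z assume v: "x \<in> ?V" "y \<in> ?V" "z \<in> ?V"
    note c = lin_closed[OF v(1)] lin_closed[OF v(2)] lin_closed[OF v(3)]
    show "vmul K n struct_consts (vmul K n struct_consts x y) z = vmul K n struct_consts x (vmul K n struct_consts y z)"
      by (rule eqI) (use v c in \<open>simp_all add: vmul_in lin_vmul L.m_assoc\<close>)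
    show "vmul K n struct_consts x y = vmul K n struct_consts y x"
      by (rule eqI) (use v c in \<open>simp_all add: vmul_in lin_vmul L.m_comm\<close>)
    show "vmul K n struct_consts ?u x = x"
      by (rule eqI) (use v c u in \<open>simp_all add: vmul_in lin_vmul\<close>)
    fix g assume g: "g < n"
    show "vapp K n act_matrices g (vmul K n struct_consts x y) = vmul K n struct_consts (vapp K n act_matrices g x) (vapp K n act_matrices g y)"
      by (rule eqI) (use v c g in \<open>simp_all add: vmul_in vapp_in lin_vmul lin_vapp ring_hom_mult[OF s_hom[OF g]]\<close>)
    show "vapp K n act_matrices g ?u = ?u"
      by (rule eqI) (use g u in \<open>simp_all add: vapp_in lin_vapp ring_hom_one[OF s_hom[OF g]]\<close>)
    fix h assume h: "h < n"
    show "vapp K n act_matrices g (vapp K n act_matrices h x) = vapp K n act_matrices (lk g h) x"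
      by (rule eqI) (use v c g h lk[OF g h] s_comp[OF g h] in \<open>simp_all add: vapp_in lin_vapp\<close>)
  next
    show "?u \<noteq> replicate n \<zero>\<^bsub>K\<^esub>"
      using u lin_zero L.one_not_zero by metis
  next
    fix x assume x: "x \<in> ?V"
    show "\<exists>y\<in>?V. x = replicate n \<zero>\<^bsub>K\<^esub> \<or> vmul K n struct_consts x y = ?u"
    proof (cases "x = replicate n \<zero>\<^bsub>K\<^esub>")
      case False
      then have "lin x \<in> Units L"
        using lin_eq_iff[OF x zero] lin_zero lin_closed[OF x] by (simp add: L.field_Units)
      then have i: "inv\<^bsub>L\<^esub> (lin x) \<in> carrier L" "lin x \<otimes>\<^bsub>L\<^esub> inv\<^bsub>L\<^esub> (lin x) = \<one>\<^bsub>L\<^esub>" by auto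
      have "vmul K n struct_consts x (coords (inv\<^bsub>L\<^esub> (lin x))) = ?u"
        by (rule eqI) (use x i u coords[OF i(1)] in \<open>simp_all add: vmul_in lin_vmul\<close>)
      then show ?thesis using coords(1)[OF i(1)] by blast
    qed (use zero in blast)
  next
    fix g h assume gh: "g < n" "h < g"
    then obtain y where y: "y \<in> carrier L" "s g y \<noteq> s h y" using s_distinct[of g h] by auto
    then have "lin (vapp K n act_matrices g (coords y)) \<noteq> lin (vapp K n act_matrices h (coords y))"
      using gh coords[OF y(1)] by (simp add: lin_vapp)
    then show "\<exists>x\<in>?V. vapp K n act_matrices g x \<noteq> vapp K n act_matrices h x" using coords(1)[OF y(1)] by metis
  qed
qed (use struct_consts_closed act_matrices_closed coords(1)[OF L.one_closed] in auto)

end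

lemma IGP_imp_galois_data:
  fixes K :: "('a, 'b) ring_scheme"
  assumes K: "field K" and IGP: "IGP K G"
    and G: "group G" and xs: "distinct xs" "set xs = carrier G" "length xs = n"
    and lk: "\<And>g h. g < n \<Longrightarrow> h < n \<Longrightarrow> lk g h < n \<and> xs ! lk g h = xs ! g \<otimes>\<^bsub>G\<^esub> xs ! h"
  shows "\<exists>c a u. galois_structure K n lk c a u"
proof -
  interpret G: group G by fact
  have n: "order G = n" using xs by (metis order_def distinct_card)
  obtain L :: "'a list ring" and h where h: "h \<in> ring_hom K L" and gal: "galois_extension L (h ` carrier K)"
    and dim: "ring.dimension L n (h ` carrier K) (carrier L)"
    and iso: "galois_group L (h ` carrier K) \<cong> G"
    using IGP unfolding IGP_def n by blast
  interpret K: field K by fact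
  interpret L: field L using gal by (simp add: galois_extension_def)
  let ?\<Gamma> = "galois_group L (h ` carrier K)"
  obtain \<psi> where \<psi>: "\<psi> \<in> iso ?\<Gamma> G" using iso by (auto simp: is_iso_def)
  then have bij: "bij_betw \<psi> (carrier ?\<Gamma>) (carrier G)" and \<psi>_hom: "\<psi> \<in> hom ?\<Gamma> G"
    by (auto simp: iso_def)
  have car: "carrier ?\<Gamma> =
      {s \<in> Bij (carrier L). s \<in> ring_hom L L \<and> (\<forall>x\<in>h ` carrier K. s x = x)}"
    by (simp add: galois_group_def)
  \<comment> \<open>The automorphism that \<open>\<psi>\<close> sends to the group element listed at
    position \<open>g\<close>.\<close>
  define s where "s g = inv_into (carrier ?\<Gamma>) \<psi> (xs ! g)" for g
  have xs_in: "xs ! g \<in> carrier G" if "g < n" for g using that xs(2,3) by (metis nth_mem)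
  have s: "s g \<in> carrier ?\<Gamma>" "\<psi> (s g) = xs ! g" if "g < n" for g
    using xs_in[OF that] bij unfolding s_def bij_betw_def by (metis inv_into_into, metis f_inv_into_f)
  have s': "s g \<in> Bij (carrier L)" "s g \<in> ring_hom L L" "\<forall>x\<in>h ` carrier K. s g x = x" if "g < n" for g
    using s(1)[OF that] unfolding car by auto
  have mult: "s g \<otimes>\<^bsub>?\<Gamma>\<^esub> s g' = compose (carrier L) (s g) (s g')" if "g < n" "g' < n" for g g'
    using s' that by (simp add: galois_group_def BijGroup_def)
  interpret galois_coordinates K L h n s lk
  proof (unfold_locales)
    show "h \<in> ring_hom K L" by (rule h)
    show "L.dimension n (h ` carrier K) (carrier L)" by (rule dim)
    show "\<exists>x\<in>carrier L. s g x \<noteq> s g' x" if "g < n" "g' < n" "g \<noteq> g'" for g g'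
    proof (rule ccontr)
      assume "\<not> ?thesis"
      \<comment> \<open>Extensional functions that agree on the carrier are equal, so different
        automorphisms differ at an element of \<open>L\<close>.\<close>
      then have "s g = s g'"
        using s'(1)[OF that(1)] s'(1)[OF that(2)]
        by (intro extensionalityI[of _ "carrier L"]) (auto simp: Bij_def)
      then have "xs ! g = xs ! g'" using s(2) that by metis
      then show False using that xs by (simp add: nth_eq_iff_index_eq)
    qed
    show "s g (s g' x) = s (lk g g') x" if g: "g < n" "g' < n" and x: "x \<in> carrier L" for g g' x
    proof -
      \<comment> \<open>Membership of the composite in the Galois group is verified directly, so
        that injectivity of \<open>\<psi>\<close> can identify it with
        \<open>s (lk g g')\<close>.\<close>
      have "compose (carrier L) (s g) (s g') \<in> carrier ?\<Gamma>"
        unfolding car using compose_Bij[OF s'(1)[OF g(1)] s'(1)[OF g(2)]] ring_hom_trans[OF s'(2)[OF g(2)] s'(2)[OF g(1)]]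
          s'(3)[OF g(1)] s'(3)[OF g(2)] ring_hom_closed[OF h]
          L.ring_hom_restrict[of "s g \<circ> s g'" L "compose (carrier L) (s g) (s g')"]
        by (auto simp: compose_def)
      moreover have "\<psi> (compose (carrier L) (s g) (s g')) = \<psi> (s (lk g g'))"
        using hom_mult[OF \<psi>_hom s(1)[OF g(1)] s(1)[OF g(2)]] mult[OF g] s(2) lk[OF g] g by simp
      ultimately have "compose (carrier L) (s g) (s g') = s (lk g g')"
        using s(1)[of "lk g g'"] lk[OF g] bij by (auto simp: bij_betw_def inj_on_def)
      from fun_cong[OF this, of x] show ?thesis using x by (simp add: compose_def)
    qed
  qed (use s' lk in auto)
  show ?thesis using galois_structure by blast
qed


section \<open>The main theorem\<close>

text \<open>Entries are looked up in the code of the table rather than in \<open>T\<close>, which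
  makes this the very formula whose code has been shown computable.\<close>

definition galois_sentence :: "nat list list \<Rightarrow> ring_formula" where
  "galois_sentence T = igp_formula (length T) (\<lambda>g h. nth_code (nth_code (table_code T) g) h)"

lemma mult_table_lookup:
  assumes "length T = n" "\<And>i. i < n \<Longrightarrow> length (T ! i) = n" "g < n" "h < n"
  shows "nth_code (nth_code (table_code T) g) h = T ! g ! h"
  using assms by (simp add: table_code_def nth_code)

lemma galois_sentence_cases:
  assumes T: "mult_table G T"
  obtains xs n lk where "distinct xs" "set xs = carrier G" "length xs = n"
    "\<And>g h. g < n \<Longrightarrow> h < n \<Longrightarrow> lk g h < n \<and> xs ! lk g h = xs ! g \<otimes>\<^bsub>G\<^esub> xs ! h"
    "galois_sentence T = igp_formula n lk"
proof -
  obtain xs where xs: "distinct xs" "set xs = carrier G" "length xs = length T"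
    and tab: "\<And>i. i < length xs \<Longrightarrow> length (T ! i) = length xs"
      "\<And>i j. i < length xs \<Longrightarrow> j < length xs \<Longrightarrow>
        T ! i ! j < length xs \<and> xs ! (T ! i ! j) = xs ! i \<otimes>\<^bsub>G\<^esub> xs ! j"
    using T unfolding mult_table_def by metis
  define lk where "lk = (\<lambda>g h. nth_code (nth_code (table_code T) g) h)"
  have "lk g h < length T \<and> xs ! lk g h = xs ! g \<otimes>\<^bsub>G\<^esub> xs ! h" if "g < length T" "h < length T" for g h
    using that tab xs(3) mult_table_lookup[of T "length T" g h] by (simp add: lk_def)
  moreover have "galois_sentence T = igp_formula (length T) lk"
    by (simp add: galois_sentence_def lk_def)
  ultimately show ?thesis using that xs by blast
qed

lemma sentence_galois_sentence:
  assumes "mult_table G T"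
  shows "sentence (galois_sentence T)"
proof -
  obtain xs n lk where *: "\<And>g h. g < n \<Longrightarrow> h < n \<Longrightarrow> lk g h < n \<and> xs ! lk g h = xs ! g \<otimes>\<^bsub>G\<^esub> xs ! h"
    and S: "galois_sentence T = igp_formula n lk"
    using galois_sentence_cases[OF assms] by metis
  have "\<And>g h. g < n \<Longrightarrow> h < n \<Longrightarrow> lk g h < n" using * by blast
  then show ?thesis unfolding S by (rule sentence_igp_formula)
qed

lemma models_galois_sentence:
  fixes K :: "('a, 'b) ring_scheme"
  assumes G: "group G" and T: "mult_table G T" and K: "field K"
  shows "K \<Turnstile> galois_sentence T \<longleftrightarrow> IGP K G"
proof -
  obtain xs n lk where xs: "distinct xs" "set xs = carrier G" and xs_n: "length xs = n"
    and lk: "\<And>g h. g < n \<Longrightarrow> h < n \<Longrightarrow> lk g h < n \<and> xs ! lk g h = xs ! g \<otimes>\<^bsub>G\<^esub> xs ! h"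
    and S: "galois_sentence T = igp_formula n lk"
    using galois_sentence_cases[OF T] by metis
  have lk_less: "\<And>g h. g < n \<Longrightarrow> h < n \<Longrightarrow> lk g h < n" using lk by blast
  have models: "K \<Turnstile> igp_formula n lk \<longleftrightarrow>
    (\<exists>C\<in>vectors K (n * n * n). \<exists>A\<in>vectors K (n * n * n). \<exists>u\<in>vectors K n.
      galois_data K n lk (mat_of n C) (mat_of n A) u)"
    by (rule models_igp_formula) (rule lk_less)
  show "K \<Turnstile> galois_sentence T \<longleftrightarrow> IGP K G"
  proof
    assume "K \<Turnstile> galois_sentence T"
    then obtain C A u where CA: "C \<in> vectors K (n * n * n)" "A \<in> vectors K (n * n * n)" "u \<in> vectors K n"
      and data: "galois_data K n lk (mat_of n C) (mat_of n A) u"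
      unfolding S models by blast
    have mat: "mat_of n M i j k \<in> carrier K"
      if "M \<in> vectors K (n * n * n)" "i < n" "j < n" "k < n" for M i j k
      unfolding mat_of_def
    proof (rule nth_vectors[OF that(1)])
      show "(i * n + j) * n + k < n * n * n" using that(2-4) by (intro index_less) auto
    qed
    have "galois_structure K n lk (mat_of n C) (mat_of n A) u"
      using K CA data mat by (simp add: galois_structure_def galois_structure_axioms_def)
    then show "IGP K G" by (rule galois_data_imp_IGP[OF _ G xs xs_n lk])
  next
    assume "IGP K G"
    then obtain c a u where "galois_structure K n lk c a u"
      using IGP_imp_galois_data[OF K _ G xs xs_n lk] by blast
    then interpret galois_structure K n lk c a u .
    obtain C where C: "C \<in> vectors K (n * n * n)" "\<forall>i<n. \<forall>j<n. \<forall>k<n. mat_of n C i j k = c i j k"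
      using ex_mat_of[of n c K] c_closed by blast
    obtain A where A: "A \<in> vectors K (n * n * n)" "\<forall>i<n. \<forall>j<n. \<forall>k<n. mat_of n A i j k = a i j k"
      using ex_mat_of[of n a K] a_closed by blast
    have "galois_data K n lk (mat_of n C) (mat_of n A) u"
      using data galois_data_cong[of n "mat_of n C" c "mat_of n A" a lk K u] C(2) A(2) lk_less by blast
    then show "K \<Turnstile> galois_sentence T"
      unfolding S models using C(1) A(1) u_closed by blast
  qed
qed

lemma effective_galois_sentence: "effective_procedure galois_sentence"
proof -
  have "computable 1 (\<lambda>e. formula_code 0 (igp_formula (length_code (e 0))
      (\<lambda>g h. nth_code (nth_code (e 0) g) h)))"
    by (rule computable_comp2[where g = "\<lambda>n t. formula_code 0 (igp_formula n (\<lambda>g h. nth_code (nth_code t g) h))",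
          OF computable_igp_formula computable_length_code[OF computable_var] computable_var]) auto
  then obtain p where p: "\<And>B xs. length xs = 1 \<Longrightarrow> computes B p xs
      (formula_code 0 (igp_formula (length_code (xs ! 0)) (\<lambda>g h. nth_code (nth_code (xs ! 0) g) h)))"
    by (rule computableE) blast
  have "computes {} p [table_code T] (sentence_code (galois_sentence T))" for T
    using p[of "[table_code T]" "{}"]
    by (simp add: sentence_code_def galois_sentence_def table_code_def length_code)
  then show ?thesis unfolding effective_procedure_def by blast
qed

section \<open>From the specification over \<open>nat\<close> to arbitrary fields and groups\<close>

lemma igp_sentence_spec:
  "effective_procedure igp_sentence"
  "group (G :: nat monoid) \<Longrightarrow> mult_table G T \<Longrightarrow> sentence (igp_sentence T)"
  "group (G :: nat monoid) \<Longrightarrow> mult_table G T \<Longrightarrow> field (K :: nat ring) \<Longrightarrow>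
    K \<Turnstile> igp_sentence T \<longleftrightarrow> IGP K G"
proof -
  let ?P = "\<lambda>S. effective_procedure S \<and> (\<forall>(G :: nat monoid) T. group G \<longrightarrow> mult_table G T \<longrightarrow>
      sentence (S T) \<and> (\<forall>K :: nat ring. field K \<longrightarrow> (K \<Turnstile> S T \<longleftrightarrow> IGP K G)))"
  have "?P galois_sentence" using effective_galois_sentence sentence_galois_sentence models_galois_sentence by blast
  then have "?P igp_sentence" unfolding igp_sentence_def by (rule someI[of ?P])
  then show "effective_procedure igp_sentence"
    "group (G :: nat monoid) \<Longrightarrow> mult_table G T \<Longrightarrow> sentence (igp_sentence T)"
    "group (G :: nat monoid) \<Longrightarrow> mult_table G T \<Longrightarrow> field (K :: nat ring) \<Longrightarrow>
      K \<Turnstile> igp_sentence T \<longleftrightarrow> IGP K G" by blast+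
qed

lemma mult_table_iso:
  assumes f: "f \<in> iso G H" and T: "mult_table G T"
  shows "mult_table H T"
proof -
  obtain xs where xs: "distinct xs" "set xs = carrier G" "length T = length xs"
    and tab: "\<forall>i<length xs. length (T ! i) = length xs \<and>
        (\<forall>j<length xs. T ! i ! j < length xs \<and> xs ! (T ! i ! j) = xs ! i \<otimes>\<^bsub>G\<^esub> xs ! j)"
    using T unfolding mult_table_def by blast
  have bij: "bij_betw f (carrier G) (carrier H)" and hom: "f \<in> hom G H" using f by (auto simp: iso_def)
  have "f (xs ! i \<otimes>\<^bsub>G\<^esub> xs ! j) = f (xs ! i) \<otimes>\<^bsub>H\<^esub> f (xs ! j)" if "i < length xs" "j < length xs" for i j
    using hom_mult[OF hom] xs(2) that by (metis nth_mem)
  then show ?thesis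
    unfolding mult_table_def using xs tab bij
    by (intro exI[of _ "map f xs"]) (auto simp: distinct_map bij_betw_def)
qed

text \<open>The listing makes the group finite, so it has a copy on \<open>nat\<close> with the same
  table, to which the specification of \<open>igp_sentence\<close> applies.\<close>

lemma group_table_of_group:
  assumes G: "group G" and T: "mult_table G T"
  shows "group_table T"
proof -
  interpret group G by fact
  obtain xs where xs: "set xs = carrier G" using T unfolding mult_table_def by blast
  have "inj_on (to_nat_on (carrier G)) (carrier G)"
    by (intro inj_on_to_nat_on countable_finite) (simp flip: xs)
  then have "group (image_group (to_nat_on (carrier G)) G)"
    "to_nat_on (carrier G) \<in> iso G (image_group (to_nat_on (carrier G)) G)"
    using inj_imp_image_group_is_group inj_imp_image_group_iso by blast+
  then show ?thesis unfolding group_table_def using mult_table_iso[OF _ T] by blast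
qed

text \<open>\<open>K'\<close> and \<open>G'\<close> are mere go-betweens. Both sentences express
  \<open>IGP K' G'\<close> in \<open>K'\<close>, hence they agree there, and elementary equivalence
  carries the agreement to \<open>K\<close>, where the meaning of \<open>galois_sentence\<close> is
  known. \<open>IGP K' G'\<close> and \<open>IGP K G\<close> are never compared directly.\<close>

lemma igp_sentence_correct:
  fixes K :: "('a, 'b) ring_scheme"
  assumes G: "group G" and T: "mult_table G T"
  shows "sentence (igp_sentence T)" "field K \<Longrightarrow> K \<Turnstile> igp_sentence T \<longleftrightarrow> IGP K G"
proof -
  obtain G' :: "nat monoid" where G': "group G'" "mult_table G' T"
    using group_table_of_group[OF G T] unfolding group_table_def by blast
  show sent: "sentence (igp_sentence T)" by (rule igp_sentence_spec(2)[OF G'])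
  assume K: "field K"
  obtain K' :: "nat ring" where K': "field K'" "\<And>\<phi>. sentence \<phi> \<Longrightarrow> K' \<Turnstile> \<phi> \<longleftrightarrow> K \<Turnstile> \<phi>"
    using loewenheim_skolem[OF K] by blast
  have "K \<Turnstile> igp_sentence T \<longleftrightarrow> K' \<Turnstile> igp_sentence T" using K'(2)[OF sent] by simp
  also have "\<dots> \<longleftrightarrow> IGP K' G'" by (rule igp_sentence_spec(3)[OF G' K'(1)])
  also have "\<dots> \<longleftrightarrow> K' \<Turnstile> galois_sentence T" by (rule models_galois_sentence[OF G' K'(1), symmetric])
  also have "\<dots> \<longleftrightarrow> K \<Turnstile> galois_sentence T" by (rule K'(2)[OF sentence_galois_sentence[OF G'(2)]])
  also have "\<dots> \<longleftrightarrow> IGP K G" by (rule models_galois_sentence[OF G T K])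
  finally show "K \<Turnstile> igp_sentence T \<longleftrightarrow> IGP K G" .
qed

section \<open>One Turing reduction for all fields\<close>

primrec oracle_free :: "program \<Rightarrow> program" where
  "oracle_free Zero = Zero"
| "oracle_free Succ = Succ"
| "oracle_free (Proj i) = Proj i"
| "oracle_free Oracle = Zero"
| "oracle_free (Comp p qs) = Comp (oracle_free p) (map oracle_free qs)"
| "oracle_free (PrimRec p q) = PrimRec (oracle_free p) (oracle_free q)"
| "oracle_free (Minim p) = Minim (oracle_free p)"

text \<open>The characteristic function of the empty set is constantly 0, so a query to it can be
  answered by \<open>Zero\<close>; the result is then independent of the oracle.\<close>

lemma computes_oracle_free: "computes {} p xs y \<Longrightarrow> computes B (oracle_free p) xs y"
proof (induction rule: computes.induct)
  case (query x)
  then show ?case using computes.zero[of B "[x]"] by simp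
next
  case (comp xs qs ys p z)
  then show ?case
    by (auto intro!: computes.comp[where ys = ys] simp: list_all2_conv_all_nth)
next
  case (minim p n xs)
  then show ?case by (auto intro!: computes.minim)
qed (auto intro: computes.intros)

lemma computes_Comp1: "computes B q xs y \<Longrightarrow> computes B p [y] z \<Longrightarrow> computes B (Comp p [q]) xs z"
  by (rule computes.comp[of _ _ _ "[y]"]) auto

lemma of_bool_eq_diff: "of_bool (m = n) = 1 - ((m - n) + (n - m) :: nat)"
  by auto

text \<open>The program is built from \<open>d\<close> and the procedures for tables and sentences
  alone, so one \<open>p\<close> serves every oracle \<open>B\<close>.\<close>

lemma numbered_sentences_reduction:
  assumes num: "effective_group_numbering \<G> \<sigma> tab"
  shows "\<exists>p. \<forall>B. reduces_via p {n. order (inv_into \<G> \<sigma> n) = d \<and>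
    sentence_code (igp_sentence (tab n)) \<in> B} B"
proof -
  interpret effective_group_numbering \<G> \<sigma> tab by fact
  have G: "group (inv_into \<G> \<sigma> n)" for n
    using finite_groups bij_betw_imp_surj_on[OF bijection] by (metis inv_into_into UNIV_I)
  have ord: "order (inv_into \<G> \<sigma> n) = length (tab n)" for n
    using table_of_number[of n] unfolding mult_table_def order_def by (metis distinct_card)
  obtain q where q: "\<And>n. computes {} q [n] (table_code (tab n))" using table_from_number by blast
  obtain r where r: "\<And>T. group_table T \<Longrightarrow> computes {} r [table_code T] (sentence_code (igp_sentence T))"
    using igp_sentence_spec(1) unfolding effective_procedure_def by blast
  have "computable 2 (\<lambda>e. (1 - ((length_code (e 0) - d) + (d - length_code (e 0)))) * e 1)"
    by (intro computable_mult computable_diff computable_add computable_length_code computable_const computable_var) auto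
  then obtain s where s: "\<And>B xs. length xs = 2 \<Longrightarrow> computes B s xs
      ((1 - ((length_code (xs ! 0) - d) + (d - length_code (xs ! 0)))) * xs ! 1)"
    by (rule computableE) blast
  \<comment> \<open>From \<open>n\<close> compute the table, then the code of its sentence, and ask
    the oracle once; \<open>s\<close> multiplies the answer by the test that the table has
    \<open>d\<close> rows, as the number of rows is the order of the group.\<close>
  define p where "p = Comp s [oracle_free q, Comp Oracle [Comp (oracle_free r) [oracle_free q]]]"
  have "computes B p [n] (of_bool (order (inv_into \<G> \<sigma> n) = d \<and> sentence_code (igp_sentence (tab n)) \<in> B))" for B n
  proof -
    let ?t = "table_code (tab n)" and ?c = "sentence_code (igp_sentence (tab n))"
    have 1: "computes B (oracle_free q) [n] ?t" by (rule computes_oracle_free[OF q])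
    have "computes B (oracle_free r) [?t] ?c"
      by (rule computes_oracle_free[OF r[OF group_table_of_group[OF G table_of_number]]])
    then have 2: "computes B (Comp Oracle [Comp (oracle_free r) [oracle_free q]]) [n] (of_bool (?c \<in> B))"
      by (intro computes_Comp1[OF computes_Comp1[OF 1] computes.query])
    have len: "length_code ?t = order (inv_into \<G> \<sigma> n)" by (simp add: ord table_code_def length_code)
    have "computes B s [?t, of_bool (?c \<in> B)] (of_bool (order (inv_into \<G> \<sigma> n) = d \<and> ?c \<in> B))"
      using s[of "[?t, of_bool (?c \<in> B)]" B] by (simp add: len of_bool_conj of_bool_eq_diff)
    then show ?thesis
      unfolding p_def using 1 2 by (intro computes.comp[of _ _ _ "[?t, of_bool (?c \<in> B)]"]) auto
  qed
  then show ?thesis unfolding reduces_via_def mem_Collect_eq by blast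
qed

lemma sentence_code_in_Th: "sentence \<phi> \<Longrightarrow> sentence_code \<phi> \<in> Th K \<longleftrightarrow> K \<Turnstile> \<phi>"
  using bij_sentence_code by (auto simp: Th_def bij_betw_def inj_on_def)

lemma realized_groups_eq:
  fixes K :: "('a, 'b) ring_scheme"
  assumes num: "effective_group_numbering \<G> \<sigma> tab" and K: "field K"
  shows "realized_groups \<G> \<sigma> K d =
    {n. order (inv_into \<G> \<sigma> n) = d \<and> sentence_code (igp_sentence (tab n)) \<in> Th K}"
proof -
  interpret effective_group_numbering \<G> \<sigma> tab by fact
  have G: "group (inv_into \<G> \<sigma> n)" for n
    using finite_groups bij_betw_imp_surj_on[OF bijection] by (metis inv_into_into UNIV_I)
  have "sentence_code (igp_sentence (tab n)) \<in> Th K \<longleftrightarrow> IGP K (inv_into \<G> \<sigma> n)" for n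
    using igp_sentence_correct[OF G table_of_number] K by (simp add: sentence_code_in_Th)
  then show ?thesis by (simp add: realized_groups_def)
qed

text \<open>Independence of the field shows in the order of quantifiers: \<open>p\<close> comes
  before \<open>B\<close> and \<open>K\<close>, and its first property mentions no field. Fields
  enter only by taking \<open>Th K\<close> for \<open>B\<close>.\<close>

theorem mainTheorem1:
  shows "(\<forall>G :: 'g monoid. group G \<and> finite (carrier G) \<longrightarrow>
      (\<exists>T. mult_table G T) \<and>
      (\<forall>T. mult_table G T \<longrightarrow> sentence (igp_sentence T) \<and>
        (\<forall>K :: 'a ring. field K \<longrightarrow> (K \<Turnstile> igp_sentence T \<longleftrightarrow> IGP K G)))) \<and>
    effective_procedure igp_sentence \<and>
    (\<forall>(\<G> :: 'g monoid set) \<sigma> tab d. effective_group_numbering \<G> \<sigma> tab \<longrightarrow>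
      (\<forall>K :: 'a ring. field K \<longrightarrow> realized_groups \<G> \<sigma> K d \<le>\<^sub>T Th K) \<and>
      (\<exists>p. (\<forall>B. reduces_via p {n. order (inv_into \<G> \<sigma> n) = d \<and>
              sentence_code (igp_sentence (tab n)) \<in> B} B) \<and>
           (\<forall>K :: 'a ring. field K \<longrightarrow> reduces_via p (realized_groups \<G> \<sigma> K d) (Th K))))"
proof (intro conjI allI impI)
  fix G :: "'g monoid" assume G: "group G \<and> finite (carrier G)"
  then show "\<exists>T. mult_table G T" using finite_group_has_mult_table by blast
  fix T assume T: "mult_table G T"
  then show "sentence (igp_sentence T)" using igp_sentence_correct(1) G by blast
  fix K :: "'a ring" assume "field K"
  then show "K \<Turnstile> igp_sentence T \<longleftrightarrow> IGP K G" using igp_sentence_correct(2) G T by blast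
next
  show "effective_procedure igp_sentence" by (rule igp_sentence_spec(1))
next
  fix \<G> :: "'g monoid set" and \<sigma> tab d
  assume num: "effective_group_numbering \<G> \<sigma> tab"
  obtain p where p: "\<And>B. reduces_via p {n. order (inv_into \<G> \<sigma> n) = d \<and>
      sentence_code (igp_sentence (tab n)) \<in> B} B"
    using numbered_sentences_reduction[OF num] by blast
  then have p_Th: "reduces_via p (realized_groups \<G> \<sigma> K d) (Th K)" if "field K" for K :: "'a ring"
    using realized_groups_eq[OF num that] by metis
  then show "\<exists>p. (\<forall>B. reduces_via p {n. order (inv_into \<G> \<sigma> n) = d \<and>
              sentence_code (igp_sentence (tab n)) \<in> B} B) \<and>
           (\<forall>K :: 'a ring. field K \<longrightarrow> reduces_via p (realized_groups \<G> \<sigma> K d) (Th K))"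
    using p by blast
  fix K :: "'a ring" assume "field K"
  then show "realized_groups \<G> \<sigma> K d \<le>\<^sub>T Th K" using p_Th unfolding turing_reducible_def by blast
qed

end
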